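(* Let $G$ be a cycle graph with $r$ vertices, $r\ge3$, and $c\in(0,1)$. We have $$d_K\big(\widetilde N^G_n,\mathcal N\big)\lesssim\begin{cases}\dfrac{1}{n\sqrt{1-p_n}} & \text{if } 0<c<p_n,\\[2mm] \dfrac{1}{n\sqrt{p_n}} & \text{if } n^{-(r-2)/(r-1)}<p_n\le c,\\[2mm] \dfrac{1}{(np_n)^{r/2}} & \text{if } 0<p_n\le n^{-(r-2)/(r-1)}.\end{cases}$$
   Context: For positive functions $f,g$, the notation $f\lesssim g$ means that $f\le C_G\,g$ for some constant $C_G>0$ depending only on $G$. $\mathbb G_n(p_n)$ is the Erdős–Rényi random graph obtained by independently retaining each edge of the complete graph $K_n$ on $n$ vertices with probability $p_n\in(0,1)$. $N^G_n$ is the number of (not necessarily induced) subgraphs of $\mathbb G_n(p_n)$ isomorphic to $G$, and $$\widetilde N^G_n=\frac{N^G_n-\mathbb E[N^G_n]}{\sqrt{\mathrm{Var}[N^G_n]}}.$$ $d_K(F,\mathcal N)=\sup_{x\in\mathbb R}|P(F\le x)-P(\mathcal N\le x)|$ is the Kolmogorov distance, where $\mathcal N$ is a standard normal random variable.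
   Formalization: The implied constant is allowed to depend on c as well as on G (uniformity in c fails, e.g. p = n^{-2}, c = p/2, where the count is mostly 0 but the first bound is of order 1/n), and n ≥ r is assumed so that the variance is nonzero. *)

theory Defs
  imports "HOL-Probability.Probability" "HOL-Library.Ramsey"
begin

text \<open>
  A finite simple graph is a pair of a vertex set \<open>V\<close> and an edge set contained in
  \<open>[V]\<^bsup>2\<^esup>\<close>, the set of two-element subsets of \<open>V\<close>.
\<close>

type_synonym 'a graph = "'a set \<times> 'a set set"

definition subgraphs :: "'a graph \<Rightarrow> 'a graph set" where
  "subgraphs H = {(V, E). V \<subseteq> fst H \<and> E \<subseteq> snd H \<and> E \<subseteq> [V]\<^bsup>2\<^esup>}"

definition graph_isomorphic :: "'a graph \<Rightarrow> 'b graph \<Rightarrow> bool" where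
  "graph_isomorphic G H \<longleftrightarrow>
     (\<exists>f. bij_betw f (fst G) (fst H) \<and> snd H = (\<lambda>e. f ` e) ` snd G)"

text \<open>
  For \<open>r < 3\<close> this is not a simple graph with \<open>r\<close> edges, so \<open>r \<ge> 3\<close> has to be assumed
  wherever it is used.
\<close>

definition cycle_graph :: "nat \<Rightarrow> nat graph" where
  "cycle_graph r = ({..<r}, {{i, (i + 1) mod r} | i. i < r})"

definition subgraph_count :: "'a graph \<Rightarrow> 'b graph \<Rightarrow> nat" where
  "subgraph_count G H = card {S \<in> subgraphs H. graph_isomorphic G S}"

definition random_graph :: "nat \<Rightarrow> real \<Rightarrow> nat graph pmf" where
  "random_graph n p =
     map_pmf (\<lambda>\<omega>. ({..<n}, {e \<in> [{..<n}]\<^bsup>2\<^esup>. \<omega> e}))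
       (Pi_pmf ([{..<n}]\<^bsup>2\<^esup>) False (\<lambda>_. bernoulli_pmf p))"

definition standardized :: "'a pmf \<Rightarrow> ('a \<Rightarrow> real) \<Rightarrow> 'a \<Rightarrow> real" where
  "standardized M X \<omega> =
     (X \<omega> - measure_pmf.expectation M X) / sqrt (measure_pmf.variance M X)"

definition normalized_count_law :: "'a graph \<Rightarrow> nat \<Rightarrow> real \<Rightarrow> real measure" where
  "normalized_count_law G n p =
     distr (measure_pmf (random_graph n p)) borel
       (standardized (random_graph n p) (\<lambda>H. real (subgraph_count G H)))"

definition kolmogorov_distance :: "real measure \<Rightarrow> real measure \<Rightarrow> real" where
  "kolmogorov_distance M N = (SUP x. \<bar>cdf M x - cdf N x\<bar>)"

end

theory Submission
  imports Defs
begin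

text \<open>
  Let \<open>X\<^sub>e\<close> be the edge indicators and \<open>W\<close> the standardized count. Telescoping each product
  \<open>\<Prod>\<^sub>e\<^sub>\<in>\<^sub>a X\<^sub>e - p\<^sup>r\<close> over the edges of a cycle \<open>a\<close> gives
  \<open>W = \<Sum>\<^sub>e (X\<^sub>e - p) \<psi>\<^sub>e\<close> with \<open>\<psi>\<^sub>e \<ge> 0\<close> independent of \<open>X\<^sub>e\<close>, so that \<open>E (W f W)\<close> is a sum of
  increments of \<open>f\<close> along the nonnegative jumps \<open>D\<^sub>e\<close> of \<open>W\<close>. If \<open>f\<close> solves Stein's equation, then
  \<open>f' = G + h - \<Phi> z\<close> with \<open>G w = w f w\<close> increasing, \<open>\<bar>G\<bar> \<le> 1\<close>, and \<open>h = 1{\<cdot> \<le> z}\<close> decreasing. Hence each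
  increment lies between values of \<open>G\<close> and \<open>h\<close> at its two end points, without any smoothness error, and
  the Kolmogorov distance is at most \<open>E \<bar>A\<^sub>+ - 1\<bar> + E \<bar>A\<^sub>- - 1\<bar>\<close>, where
  \<open>A\<^sub>+ = (1 - p) \<Sum>\<^sub>e X\<^sub>e \<psi>\<^sub>e D\<^sub>e\<close> and \<open>A\<^sub>- = p \<Sum>\<^sub>e (1 - X\<^sub>e) \<psi>\<^sub>e D\<^sub>e\<close> both have mean 1.

  The variances of \<open>A\<^sub>+\<close> and \<open>A\<^sub>-\<close> are sums over quadruples of cycles glued together along edges. As
  every part of a cycle with \<open>k\<close> edges, \<open>0 < k < r\<close>, has at least \<open>k + 1\<close> vertices, each gluing saves a
  factor \<open>m = min (n\<^sup>2 p) ((n p)\<^sup>r)\<close> as soon as \<open>n p \<ge> 1\<close>. Together with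
  \<open>Var N \<ge> const (1 - p) (n p)\<^bsup>2 r\<^esup> / m\<close> this bounds the distance by \<open>const / sqrt ((1 - p) m)\<close>.
\<close>

section \<open>The normal distribution function and Stein's equation\<close>

definition Phi :: "real \<Rightarrow> real" where
  "Phi = cdf std_normal_distribution"

interpretation std_normal: real_distribution std_normal_distribution
  by (rule real_dist_normal_dist)

lemma Phi_diff_eq_integral:
  assumes "a \<le> u"
  shows "Phi u - Phi a = (LBINT y=a..u. std_normal_density y)"
proof (cases "a = u")
  case False
  then have "a < u" using assms by simp
  have "Phi u - Phi a = measure std_normal_distribution {a<..u}"
    unfolding Phi_def by (rule std_normal.cdf_diff_eq[OF \<open>a < u\<close>])
  also have "\<dots> = (\<integral>x. indicator {a<..u} x \<partial>std_normal_distribution)"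
    by simp
  also have "\<dots> = (\<integral>x. std_normal_density x *\<^sub>R indicator {a<..u} x \<partial>lborel)"
    by (rule integral_density) auto
  also have "\<dots> = (LBINT y=a..u. std_normal_density y)"
    using \<open>a < u\<close> by (simp add: interval_integral_Ioc set_lebesgue_integral_def mult.commute)
  finally show ?thesis .
qed simp

lemma Phi_has_real_derivative:
  "(Phi has_real_derivative std_normal_density x) (at x)"
proof -
  have cont: "continuous_on {x - 1..x + 1} std_normal_density"
    unfolding std_normal_density_def by (intro continuous_intros) auto
  have "((\<lambda>u. LBINT y=(x - 1)..u. std_normal_density y) has_vector_derivative
      std_normal_density x) (at x within {x - 1..x + 1})"
    using interval_integral_FTC2[of "x - 1" "x - 1" "x + 1" std_normal_density x] cont by simp
  then have "((\<lambda>u. Phi (x - 1) + (LBINT y=(x - 1)..u. std_normal_density y)) has_real_derivative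
      std_normal_density x) (at x within {x - 1..x + 1})"
    unfolding has_real_derivative_iff_has_vector_derivative
    using has_vector_derivative_add[OF has_vector_derivative_const] by fastforce
  then have "(Phi has_real_derivative std_normal_density x) (at x within {x - 1..x + 1})"
  proof (rule has_field_derivative_transform_within[where d = 1])
    fix u assume "u \<in> {x - 1..x + 1}"
    then show "Phi (x - 1) + (LBINT y=(x - 1)..u. std_normal_density y) = Phi u"
      using Phi_diff_eq_integral[of "x - 1" u] by simp
  qed auto
  then show ?thesis
    using at_within_Icc_at[of "x - 1" x "x + 1"] by simp
qed

lemma Phi_at_bot: "(Phi \<longlongrightarrow> 0) at_bot"
  unfolding Phi_def by (rule std_normal.cdf_lim_at_bot)

lemma Phi_at_top: "(Phi \<longlongrightarrow> 1) at_top"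
  unfolding Phi_def by (rule std_normal.cdf_lim_at_top_prob)

lemma Phi_nonneg: "0 \<le> Phi x" and Phi_le_1: "Phi x \<le> 1"
  unfolding Phi_def by (rule std_normal.cdf_nonneg std_normal.cdf_bounded_prob)+

lemma std_normal_density_has_derivative:
  "(std_normal_density has_real_derivative - x * std_normal_density x) (at x)"
  unfolding std_normal_density_def
  by (rule derivative_eq_intros refl | simp add: field_simps)+

text \<open>The density is even, so \<open>Phi x + Phi (- x)\<close> has derivative 0, and its limit
  at infinity identifies the constant as 1.\<close>

lemma Phi_minus: "Phi (- x) = 1 - Phi x"
proof -
  define g where "g x = Phi x + Phi (- x)" for x
  have "(g has_real_derivative 0) (at x)" for x
    unfolding g_def
    by (auto intro!: derivative_eq_intros Phi_has_real_derivative
        DERIV_chain'[where f = uminus and g = Phi] simp: std_normal_density_def)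
  then have const: "g x = g 0" for x
    using DERIV_isconst_all by blast
  have "((\<lambda>x. Phi (- x)) \<longlongrightarrow> 0) at_top"
    using Phi_at_bot by (simp add: filterlim_at_bot_mirror)
  then have "(g \<longlongrightarrow> 1 + 0) at_top"
    unfolding g_def by (intro tendsto_add Phi_at_top)
  moreover have "g = (\<lambda>_. g 0)"
    using const by blast
  ultimately have "g 0 = 1"
    using tendsto_unique[OF trivial_limit_at_top_linorder, of g "1 + 0" "g 0"]
    by (metis add.right_neutral tendsto_const)
  then show ?thesis
    using const[of x] by (simp add: g_def)
qed

section \<open>Mills ratio estimates\<close>

lemma Phi_mills_upper: "- w * Phi w \<le> std_normal_density w"
proof (cases "w < 0")
  case True
  \<comment> \<open>\<open>g\<close> vanishes at minus infinity and has positive derivative on the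
    negative axis, so \<open>g w > 0\<close>; multiplying by \<open>- w > 0\<close> gives the
    claim.\<close>
  define g where "g x = - Phi x - std_normal_density x / x" for x
  have "(g has_real_derivative std_normal_density x / x\<^sup>2) (at x)" if "x \<le> w" for x
    unfolding g_def using that True
    by (auto intro!: derivative_eq_intros Phi_has_real_derivative std_normal_density_has_derivative
        simp: field_simps power2_eq_square)
  then have "\<exists>y. (g has_real_derivative y) (at x) \<and> y > 0" if "x \<le> w" for x
    using that True by (intro exI[of _ "std_normal_density x / x\<^sup>2"] conjI)
      (auto intro!: divide_pos_pos simp: normal_density_pos)
  moreover have "(g \<longlongrightarrow> - 0 - 0) at_bot"
    unfolding g_def std_normal_density_def
    by (intro tendsto_diff tendsto_minus Phi_at_bot) real_asymp
  ultimately have "0 < g w"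
    by (intro DERIV_pos_imp_increasing_at_bot) auto
  then show ?thesis
    using True by (simp add: g_def field_simps)
next
  case False
  then have "- w * Phi w \<le> 0" by (simp add: Phi_nonneg)
  also have "0 \<le> std_normal_density w" by simp
  finally show ?thesis .
qed

text \<open>The same method as for the upper estimate:
  \<open>Phi x + x / (1 + x\<^sup>2) * std_normal_density x\<close> tends to 0 at minus infinity and
  increases. The form chosen is, up to a positive factor, the derivative of
  \<open>w * stein_left w\<close>.\<close>

lemma Phi_mills_lower: "0 \<le> (1 + w\<^sup>2) * Phi w + w * std_normal_density w"
proof -
  define g where "g x = Phi x + x / (1 + x\<^sup>2) * std_normal_density x" for x
  have pos: "1 + x\<^sup>2 > 0" for x :: real
    by (simp add: add_pos_nonneg)
  have "(g has_real_derivative 2 * std_normal_density x / (1 + x\<^sup>2)\<^sup>2) (at x)" for x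
  proof -
    have "(g has_real_derivative std_normal_density x +
        (((1 + x\<^sup>2) - x * (2 * x)) / ((1 + x\<^sup>2) * (1 + x\<^sup>2)) * std_normal_density x
          + - x * std_normal_density x * (x / (1 + x\<^sup>2)))) (at x)"
      unfolding g_def
      by (intro DERIV_add DERIV_mult Phi_has_real_derivative std_normal_density_has_derivative)
        (use pos[of x] in \<open>auto intro!: derivative_eq_intros simp: power2_eq_square\<close>)
    moreover have "std_normal_density x +
        (((1 + x\<^sup>2) - x * (2 * x)) / ((1 + x\<^sup>2) * (1 + x\<^sup>2)) * std_normal_density x
          + - x * std_normal_density x * (x / (1 + x\<^sup>2)))
        = 2 * std_normal_density x / (1 + x\<^sup>2)\<^sup>2"
      using pos[of x] by (simp add: divide_simps) (simp add: algebra_simps power2_eq_square)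
    ultimately show ?thesis by simp
  qed
  then have "\<exists>y. (g has_real_derivative y) (at x) \<and> y > 0" for x
    using pos[of x] by (intro exI[of _ "2 * std_normal_density x / (1 + x\<^sup>2)\<^sup>2"] conjI)
      (auto intro!: divide_pos_pos mult_pos_pos simp: normal_density_pos)
  moreover have "(g \<longlongrightarrow> 0 + 0) at_bot"
    unfolding g_def std_normal_density_def
    by (intro tendsto_add Phi_at_bot) real_asymp
  ultimately have "0 < g w"
    by (intro DERIV_pos_imp_increasing_at_bot) auto
  then show ?thesis
    using pos[of w] by (simp add: g_def field_simps)
qed

section \<open>The solution of Stein's equation for a half-line\<close>

definition stein_left :: "real \<Rightarrow> real" where
  "stein_left w = sqrt (2 * pi) * exp (w\<^sup>2 / 2) * Phi w"

lemma sqrt_exp_std_normal_density: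
  "sqrt (2 * pi) * exp (w\<^sup>2 / 2) * std_normal_density w = 1"
  by (simp add: std_normal_density_def exp_minus field_simps)

text \<open>\<open>stein_left\<close> is \<open>Phi\<close> divided by the normal density, that is,
  the Mills ratio at \<open>- w\<close>. It solves f' w - w f w = 1, so its multiples can serve as
  branches of the Stein solution.\<close>

lemma stein_left_has_derivative:
  "(stein_left has_real_derivative w * stein_left w + 1) (at w)"
proof -
  have "(stein_left has_real_derivative sqrt (2 * pi) * (exp (w\<^sup>2 / 2) * w) * Phi w
     + sqrt (2 * pi) * exp (w\<^sup>2 / 2) * std_normal_density w) (at w)"
    unfolding stein_left_def
    by (auto intro!: derivative_eq_intros Phi_has_real_derivative simp: algebra_simps)
  then show ?thesis
    by (simp add: sqrt_exp_std_normal_density) (simp add: stein_left_def mult_ac)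
qed

lemma stein_left_lower: "- w * stein_left w \<le> 1"
proof -
  have "sqrt (2 * pi) * exp (w\<^sup>2 / 2) * (- w * Phi w)
      \<le> sqrt (2 * pi) * exp (w\<^sup>2 / 2) * std_normal_density w"
    by (intro mult_left_mono Phi_mills_upper) auto
  then show ?thesis
    unfolding sqrt_exp_std_normal_density by (simp add: stein_left_def mult_ac)
qed

lemma stein_left_mult_mono:
  assumes "v \<le> w"
  shows "v * stein_left v \<le> w * stein_left w"
proof (rule DERIV_nonneg_imp_nondecreasing[OF assms])
  fix x
  \<comment> \<open>The derivative of \<open>x * stein_left x\<close> is the reciprocal of the
    density times the expression in \<open>Phi_mills_lower\<close>.\<close>
  have "sqrt (2 * pi) * exp (x\<^sup>2 / 2) * ((1 + x\<^sup>2) * Phi x + x * std_normal_density x)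
      = stein_left x + x * (x * stein_left x + 1)"
    using sqrt_exp_std_normal_density[of x]
    by (simp add: stein_left_def distrib_left distrib_right power2_eq_square mult_ac)
  moreover have "0 \<le> sqrt (2 * pi) * exp (x\<^sup>2 / 2) * ((1 + x\<^sup>2) * Phi x + x * std_normal_density x)"
    using Phi_mills_lower[of x] by (intro mult_nonneg_nonneg) auto
  ultimately have "0 \<le> stein_left x + x * (x * stein_left x + 1)"
    by simp
  moreover have "((\<lambda>a. a * stein_left a) has_real_derivative
      stein_left x + x * (x * stein_left x + 1)) (at x)"
    by (auto intro!: derivative_eq_intros stein_left_has_derivative)
  ultimately show "\<exists>y. ((\<lambda>a. a * stein_left a) has_real_derivative y) (at x) \<and> 0 \<le> y"
    by blast
qed

text \<open>The solution of Stein's equation \<open>f' w - w f w = 1{w \<le> z} - Phi z\<close>;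
  the right branch is the mirror image of the left one, since \<open>1 - Phi w = Phi (- w)\<close>.\<close>

definition stein_sol :: "real \<Rightarrow> real \<Rightarrow> real" where
  "stein_sol z w = (if w \<le> z then (1 - Phi z) * stein_left w else Phi z * stein_left (- w))"

text \<open>The two branches agree at \<open>z\<close> because \<open>1 - Phi z = Phi (- z)\<close>.
  This continuity lets each branch be used on a closed half-line.\<close>

lemma stein_sol_right:
  assumes "z \<le> w"
  shows "stein_sol z w = Phi z * stein_left (- w)"
proof (cases "w = z")
  case True
  then show ?thesis
    using Phi_minus[of z] by (simp add: stein_sol_def stein_left_def)
qed (use assms in \<open>simp add: stein_sol_def\<close>)

text \<open>Each branch inherits monotonicity from \<open>stein_left\<close>, the right one through
  the reflection w to -w; the two are joined at the common point \<open>z\<close>.\<close>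

lemma stein_sol_mult_mono:
  assumes "v \<le> w"
  shows "v * stein_sol z v \<le> w * stein_sol z w"
proof -
  have left: "v * stein_sol z v \<le> w * stein_sol z w" if "v \<le> w" "w \<le> z" for v w
    using that mult_left_mono[OF stein_left_mult_mono[OF that(1)], of "1 - Phi z"] Phi_le_1[of z]
    by (simp add: stein_sol_def mult_ac)
  have right: "v * stein_sol z v \<le> w * stein_sol z w" if "v \<le> w" "z \<le> v" for v w
    using that mult_left_mono[OF stein_left_mult_mono[of "- w" "- v"], of "Phi z"] Phi_nonneg[of z]
    by (simp add: stein_sol_right mult_ac)
  consider "w \<le> z" | "z \<le> v" | "v \<le> z" "z \<le> w"
    by linarith
  then show ?thesis
    using left right assms by cases (blast, blast, meson order_trans order_refl)
qed

text \<open>The upper bound comes from \<open>stein_left_lower\<close> for \<open>w \<ge> z\<close>,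
  the lower bound from it for \<open>w \<le> z\<close>. Monotonicity through the point
  \<open>z\<close> extends both to all \<open>w\<close>.\<close>

lemma stein_sol_mult_bound: "\<bar>w * stein_sol z w\<bar> \<le> 1"
proof -
  have at_z: "w * stein_sol z w \<le> 1" if "w \<ge> z" for w
  proof -
    have "w * stein_left (- w) \<le> 1"
      using stein_left_lower[of "- w"] by simp
    then have "Phi z * (w * stein_left (- w)) \<le> 1"
      using Phi_nonneg[of z] Phi_le_1[of z]
      by (smt (verit, best) mult_left_le mult_nonneg_nonpos)
    then show ?thesis
      by (simp add: stein_sol_right[OF that] mult_ac)
  qed
  have at_z': "- 1 \<le> w * stein_sol z w" if "w \<le> z" for w
  proof -
    have "(1 - Phi z) * (- w * stein_left w) \<le> 1"
      using stein_left_lower[of w] Phi_nonneg[of z] Phi_le_1[of z]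
      by (smt (verit, best) mult_left_le mult_nonneg_nonpos)
    then show ?thesis
      using that by (simp add: stein_sol_def mult_ac)
  qed
  have "w * stein_sol z w \<le> 1"
    using at_z[of w] at_z[of z] stein_sol_mult_mono[of w z z] by linarith
  moreover have "- 1 \<le> w * stein_sol z w"
    using at_z'[of w] at_z'[of z] stein_sol_mult_mono[of z w z] by linarith
  ultimately show ?thesis by linarith
qed

text \<open>On either side of \<open>z\<close> the derivative is \<open>G + h - Phi z\<close>. By
  the mean value theorem the increment is governed by an intermediate value, which lies between end
  point values since \<open>G\<close> increases and \<open>h\<close> decreases.\<close>

lemma stein_sol_increment:
  fixes a b z :: real
  assumes "a \<le> b"
  defines "G \<equiv> \<lambda>w. w * stein_sol z w" and "h \<equiv> \<lambda>w. of_bool (w \<le> z)"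
  shows "(b - a) * (G a + h b - Phi z) \<le> stein_sol z b - stein_sol z a" (is ?lower)
    and "stein_sol z b - stein_sol z a \<le> (b - a) * (G b + h a - Phi z)" (is ?upper)
proof -
  let ?P = "\<lambda>a b. (b - a) * (G a + h b - Phi z) \<le> stein_sol z b - stein_sol z a \<and>
    stein_sol z b - stein_sol z a \<le> (b - a) * (G b + h a - Phi z)"
  \<comment> \<open>Here \<open>s\<close> is the constant standing for \<open>h\<close> on a piece
    with smooth formula \<open>g\<close>. It only has to lie between \<open>h b\<close> and
    \<open>h a\<close>, which allows \<open>s = 0\<close> on a piece starting at \<open>z\<close>,
    where \<open>h z = 1\<close>.\<close>
  have mvt: "?P a b" if "a \<le> b" and
      der: "\<And>x. a \<le> x \<Longrightarrow> x \<le> b \<Longrightarrow> (g has_real_derivative G x + s - Phi z) (at x)"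
      and eq: "\<And>x. a \<le> x \<Longrightarrow> x \<le> b \<Longrightarrow> g x = stein_sol z x" and s: "h b \<le> s" "s \<le> h a"
    for a b s g
  proof (cases "a = b")
    case False
    then have "a < b" using that by simp
    then obtain x where x: "a < x" "x < b" "g b - g a = (b - a) * (G x + s - Phi z)"
      using MVT2[of a b g "\<lambda>x. G x + s - Phi z"] der by auto
    have "G a \<le> G x" "G x \<le> G b"
      using x unfolding G_def by (auto intro!: stein_sol_mult_mono)
    then have "(b - a) * (G a + h b - Phi z) \<le> (b - a) * (G x + s - Phi z)"
      "(b - a) * (G x + s - Phi z) \<le> (b - a) * (G b + h a - Phi z)"
      using \<open>a < b\<close> s by (auto intro!: mult_left_mono)
    then show ?thesis
      using x(3) eq[of a] eq[of b] \<open>a < b\<close> by simp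
  qed simp
  have left: "?P a b" if "a \<le> b" "b \<le> z" for a b
  proof (rule mvt[where g = "\<lambda>w. (1 - Phi z) * stein_left w" and s = 1])
    fix x assume "a \<le> x" "x \<le> b"
    then show "((\<lambda>w. (1 - Phi z) * stein_left w) has_real_derivative G x + 1 - Phi z) (at x)"
      using that by (auto intro!: derivative_eq_intros stein_left_has_derivative
          simp: G_def stein_sol_def algebra_simps)
  qed (use that in \<open>auto simp: stein_sol_def h_def\<close>)
  \<comment> \<open>The strict inequality makes \<open>h b = 0\<close> even if
    \<open>a = z\<close>.\<close>
  have right: "?P a b" if "z \<le> a" "a < b" for a b
  proof (rule mvt[where g = "\<lambda>w. Phi z * stein_left (- w)" and s = 0])
    fix x assume x: "a \<le> x" "x \<le> b"
    have "((\<lambda>w. Phi z * stein_left (- w)) has_real_derivative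
        Phi z * (- ((- x) * stein_left (- x) + 1))) (at x)"
      by (auto intro!: derivative_eq_intros
          DERIV_chain'[where f = uminus and g = stein_left] stein_left_has_derivative)
    then show "((\<lambda>w. Phi z * stein_left (- w)) has_real_derivative G x + 0 - Phi z) (at x)"
      using that x by (simp add: G_def stein_sol_right algebra_simps)
    show "Phi z * stein_left (- x) = stein_sol z x"
      using that x by (simp add: stein_sol_right)
  qed (use that in \<open>auto simp: h_def\<close>)
  have "?P a b"
  proof -
    consider "b \<le> z" | "z \<le> a" "a < b" | "a = b" | "a \<le> z" "z < b"
      using assms(1) by (cases "b \<le> z"; cases "z \<le> a"; cases "a = b") (simp_all add: order_less_le)
    then show ?thesis
    proof cases
      \<comment> \<open>An interval that crosses \<open>z\<close> is cut there. The end point bounds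
        of the two pieces are weakened to the same factor, so that the lengths add up to
        \<open>b - a\<close>.\<close>
      case 4
      have h: "h a = 1" "h z = 1" "h b = 0"
        using 4 by (auto simp: h_def)
      have G: "G a \<le> G z" "G z \<le> G b"
        using 4 unfolding G_def by (auto intro!: stein_sol_mult_mono)
      have "(z - a) * (G a + 0 - Phi z) \<le> (z - a) * (G a + h z - Phi z)"
        "(b - z) * (G a + 0 - Phi z) \<le> (b - z) * (G z + h b - Phi z)"
        "(z - a) * (G z + h a - Phi z) \<le> (z - a) * (G b + 1 - Phi z)"
        using 4 G h by (auto intro!: mult_left_mono)
      moreover have "(b - a) * t = (z - a) * t + (b - z) * t" for t
        by (simp add: algebra_simps)
      moreover note left[OF 4(1) order_refl] right[OF order_refl 4(2)]
      ultimately show ?thesis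
        unfolding h by (smt (verit, best))
    next
      case 1
      then show ?thesis by (rule left[OF \<open>a \<le> b\<close>])
    next
      case 2
      then show ?thesis by (rule right)
    next
      case 3
      then show ?thesis by simp
    qed
  qed
  then show ?lower ?upper by auto
qed

section \<open>Functions of a random subset\<close>

text \<open>Expectation under the law of a random subset of \<open>E\<close> containing each element
  independently with probability \<open>p\<close>. As a finite sum it raises no question of
  measurability or integrability.\<close>

definition subset_expectation :: "'e set \<Rightarrow> real \<Rightarrow> ('e set \<Rightarrow> real) \<Rightarrow> real" where
  "subset_expectation E p F = (\<Sum>A\<in>Pow E. p ^ card A * (1 - p) ^ card (E - A) * F A)"

lemma subset_expectation_empty: "subset_expectation {} p F = F {}"
  by (simp add: subset_expectation_def)

text \<open>Conditioning on whether \<open>e\<close> is selected splits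
  \<open>Pow (insert e E)\<close> into two copies of \<open>Pow E\<close>.\<close>

lemma subset_expectation_insert:
  assumes "finite E" "e \<notin> E"
  shows "subset_expectation (insert e E) p F =
    p * subset_expectation E p (\<lambda>A. F (insert e A)) + (1 - p) * subset_expectation E p F"
proof -
  have inj: "inj_on (insert e) (Pow E)"
    using assms by (auto simp: inj_on_def)
  have "subset_expectation (insert e E) p F =
      (\<Sum>A\<in>Pow E. p ^ card A * (1 - p) ^ card (insert e E - A) * F A) +
      (\<Sum>A\<in>insert e ` Pow E. p ^ card A * (1 - p) ^ card (insert e E - A) * F A)"
    unfolding subset_expectation_def Pow_insert
    using assms by (intro sum.union_disjoint) auto
  also have "(\<Sum>A\<in>Pow E. p ^ card A * (1 - p) ^ card (insert e E - A) * F A) =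
      (1 - p) * subset_expectation E p F"
    unfolding subset_expectation_def sum_distrib_left
  proof (intro sum.cong refl)
    fix A assume "A \<in> Pow E"
    then have "insert e E - A = insert e (E - A)" "e \<notin> E - A" "finite (E - A)"
      using assms by auto
    then show "p ^ card A * (1 - p) ^ card (insert e E - A) * F A =
        (1 - p) * (p ^ card A * (1 - p) ^ card (E - A) * F A)"
      by simp
  qed
  also have "(\<Sum>A\<in>insert e ` Pow E. p ^ card A * (1 - p) ^ card (insert e E - A) * F A) =
      p * subset_expectation E p (\<lambda>A. F (insert e A))"
    unfolding subset_expectation_def sum_distrib_left sum.reindex[OF inj] o_def
  proof (intro sum.cong refl)
    fix A assume "A \<in> Pow E"
    then have "insert e E - insert e A = E - A" "e \<notin> A" "finite A"
      using assms by (auto intro: finite_subset)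
    then show "p ^ card (insert e A) * (1 - p) ^ card (insert e E - insert e A) * F (insert e A) =
        p * (p ^ card A * (1 - p) ^ card (E - A) * F (insert e A))"
      by simp
  qed
  finally show ?thesis by simp
qed

lemma subset_expectation_add:
  "subset_expectation E p (\<lambda>A. F A + H A) = subset_expectation E p F + subset_expectation E p H"
  by (simp add: subset_expectation_def distrib_left sum.distrib)

lemma subset_expectation_diff:
  "subset_expectation E p (\<lambda>A. F A - H A) = subset_expectation E p F - subset_expectation E p H"
  by (simp add: subset_expectation_def right_diff_distrib sum_subtractf)

lemma subset_expectation_cmult:
  "subset_expectation E p (\<lambda>A. k * F A) = k * subset_expectation E p F"
  by (simp add: subset_expectation_def sum_distrib_left mult_ac)

lemma subset_expectation_sum:
  "subset_expectation E p (\<lambda>A. \<Sum>i\<in>I. F i A) = (\<Sum>i\<in>I. subset_expectation E p (F i))"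
  unfolding subset_expectation_def sum_distrib_left by (rule sum.swap)

lemma subset_expectation_cong:
  assumes "\<And>A. A \<subseteq> E \<Longrightarrow> F A = H A"
  shows "subset_expectation E p F = subset_expectation E p H"
  unfolding subset_expectation_def using assms by (intro sum.cong) auto

lemma subset_expectation_const: "finite E \<Longrightarrow> subset_expectation E p (\<lambda>_. k) = k"
proof (induction E rule: finite_induct)
  case (insert e E)
  then show ?case
    by (simp add: subset_expectation_insert algebra_simps)
qed (simp add: subset_expectation_empty)

text \<open>The presence of \<open>e\<close> has probability \<open>p\<close> and is independent of
  \<open>F (insert e A)\<close>, which is a function of the other elements only.\<close>

lemma subset_expectation_in:
  assumes "finite E" "e \<in> E"
  shows "subset_expectation E p (\<lambda>A. of_bool (e \<in> A) * F A) =
    p * subset_expectation E p (\<lambda>A. F (insert e A))"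
proof -
  obtain E' where E: "E = insert e E'" "e \<notin> E'"
    using assms by (meson mk_disjoint_insert)
  have "subset_expectation E' p (\<lambda>A. of_bool (e \<in> A) * F A) = subset_expectation E' p (\<lambda>A. 0 * F A)"
    using E by (intro subset_expectation_cong) auto
  then have "subset_expectation E' p (\<lambda>A. of_bool (e \<in> A) * F A) = 0"
    by (simp only: subset_expectation_cmult)
  then show ?thesis
    using E assms by (simp add: subset_expectation_insert algebra_simps)
qed

lemma subset_expectation_notin:
  assumes "finite E" "e \<in> E"
  shows "subset_expectation E p (\<lambda>A. of_bool (e \<notin> A) * F A) =
    (1 - p) * subset_expectation E p (\<lambda>A. F (A - {e}))"
proof -
  obtain E' where E: "E = insert e E'" "e \<notin> E'"
    using assms by (meson mk_disjoint_insert)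
  have "subset_expectation E' p (\<lambda>A. F (A - {e})) = subset_expectation E' p F"
    "subset_expectation E' p (\<lambda>A. of_bool (e \<notin> A) * F A) = subset_expectation E' p F"
    using E by (auto intro!: subset_expectation_cong arg_cong[where f = F])
  moreover have "subset_expectation E' p (\<lambda>A. F (insert e A - {e})) = subset_expectation E' p F"
    using E by (auto intro!: subset_expectation_cong arg_cong[where f = F])
  moreover have "subset_expectation E' p (\<lambda>A. 0 * F (insert e A)) = 0"
    by (simp only: subset_expectation_cmult)
  ultimately show ?thesis
    using E assms by (simp add: subset_expectation_insert algebra_simps)
qed

lemma subset_expectation_subset:
  assumes "finite E" "A \<subseteq> E"
  shows "subset_expectation E p (\<lambda>B. of_bool (A \<subseteq> B)) = p ^ card A"
proof -
  have "finite A" using assms finite_subset by blast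
  then show ?thesis using assms(2)
  proof (induction A rule: finite_induct)
    case empty
    then show ?case using assms by (simp add: subset_expectation_const)
  next
    case (insert e A)
    have "subset_expectation E p (\<lambda>B. of_bool (insert e A \<subseteq> B)) =
        subset_expectation E p (\<lambda>B. of_bool (e \<in> B) * of_bool (A \<subseteq> B))"
      by (intro subset_expectation_cong) auto
    also have "\<dots> = p * subset_expectation E p (\<lambda>B. of_bool (A \<subseteq> insert e B))"
      using insert assms by (intro subset_expectation_in) auto
    also have "(\<lambda>B. of_bool (A \<subseteq> insert e B)) = (\<lambda>B. of_bool (A \<subseteq> B) :: real)"
      using insert by (intro ext arg_cong[where f = of_bool]) auto
    finally show ?case using insert by simp
  qed
qed

section \<open>Integration by parts and Stein's method for random subsets\<close>

context
  fixes E :: "'e set" and p :: real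
  assumes finite_E: "finite E" and p01: "0 < p" "p < 1"
begin

lemma subset_expectation_mono:
  assumes "\<And>A. A \<subseteq> E \<Longrightarrow> F A \<le> H A"
  shows "subset_expectation E p F \<le> subset_expectation E p H"
  unfolding subset_expectation_def using assms p01
  by (intro sum_mono mult_left_mono) auto

lemma subset_expectation_abs_le:
  "\<bar>subset_expectation E p F\<bar> \<le> subset_expectation E p (\<lambda>A. \<bar>F A\<bar>)"
proof -
  have "subset_expectation E p F \<le> subset_expectation E p (\<lambda>A. \<bar>F A\<bar>)"
    by (intro subset_expectation_mono) auto
  moreover have "subset_expectation E p (\<lambda>A. (- 1) * F A) \<le> subset_expectation E p (\<lambda>A. \<bar>F A\<bar>)"
    by (intro subset_expectation_mono) auto
  ultimately show ?thesis
    unfolding subset_expectation_cmult by linarith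
qed

text \<open>The variance of \<open>\<bar>F\<bar>\<close> is nonnegative.\<close>

lemma subset_expectation_abs_le_sqrt:
  "subset_expectation E p (\<lambda>A. \<bar>F A\<bar>) \<le> sqrt (subset_expectation E p (\<lambda>A. (F A)\<^sup>2))"
proof -
  define m where "m = subset_expectation E p (\<lambda>A. \<bar>F A\<bar>)"
  have "0 \<le> subset_expectation E p (\<lambda>A. (\<bar>F A\<bar> - m)\<^sup>2)"
    using subset_expectation_mono[of "\<lambda>_. 0"] subset_expectation_const[OF finite_E] by simp
  also have "\<dots> = subset_expectation E p (\<lambda>A. (F A)\<^sup>2 - 2 * m * \<bar>F A\<bar> + m\<^sup>2)"
    by (intro subset_expectation_cong) (simp add: power2_diff)
  also have "\<dots> = subset_expectation E p (\<lambda>A. (F A)\<^sup>2) - m\<^sup>2"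
    by (simp add: subset_expectation_add subset_expectation_diff subset_expectation_cmult
        subset_expectation_const[OF finite_E] flip: m_def) (simp add: power2_eq_square)
  finally show ?thesis
    unfolding m_def[symmetric] by (intro real_le_rsqrt) simp
qed

text \<open>Discrete integration by parts: a centred indicator is traded for its variance
  \<open>p * (1 - p)\<close> and the difference of \<open>K\<close> in direction
  \<open>e\<close>.\<close>

lemma subset_expectation_ibp:
  assumes "e \<in> E"
  shows "subset_expectation E p (\<lambda>A. (of_bool (e \<in> A) - p) * K A) =
    p * (1 - p) * subset_expectation E p (\<lambda>A. K (insert e A) - K (A - {e}))"
proof -
  have "subset_expectation E p (\<lambda>A. (of_bool (e \<in> A) - p) * K A) =
      subset_expectation E p (\<lambda>A. (1 - p) * (of_bool (e \<in> A) * K A) - p * (of_bool (e \<notin> A) * K A))"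
    by (intro subset_expectation_cong) (auto simp: algebra_simps)
  also have "\<dots> = p * (1 - p) * subset_expectation E p (\<lambda>A. K (insert e A) - K (A - {e}))"
    unfolding subset_expectation_diff subset_expectation_cmult
      subset_expectation_in[OF finite_E assms] subset_expectation_notin[OF finite_E assms]
    by (simp add: algebra_simps)
  finally show ?thesis .
qed

text \<open>Integration by parts with \<open>K = \<psi> e * H\<close> turns the expectation of
  \<open>W * H\<close> into weighted increments of \<open>H\<close>, since \<open>\<psi> e\<close>
  does not see \<open>e\<close>. For \<open>H = W\<close> the total weight is the variance 1. For
  the Stein solution the increments are squeezed by \<open>stein_sol_increment\<close>.\<close>

lemma stein_kolmogorov_bound:
  fixes W :: "'e set \<Rightarrow> real" and \<psi> D :: "'e \<Rightarrow> 'e set \<Rightarrow> real"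
  assumes W: "\<And>A. A \<subseteq> E \<Longrightarrow> W A = (\<Sum>e\<in>E. (of_bool (e \<in> A) - p) * \<psi> e A)"
    and \<psi>_indep: "\<And>e A. e \<in> E \<Longrightarrow> \<psi> e (insert e A) = \<psi> e (A - {e})"
    and D: "\<And>e A. e \<in> E \<Longrightarrow> A \<subseteq> E \<Longrightarrow> D e A = W (insert e A) - W (A - {e})"
    and nonneg: "\<And>e A. 0 \<le> \<psi> e A" "\<And>e A. 0 \<le> D e A"
    and W_var: "subset_expectation E p (\<lambda>A. (W A)\<^sup>2) = 1"
  defines "Ap \<equiv> \<lambda>A. (1 - p) * (\<Sum>e\<in>E. of_bool (e \<in> A) * (\<psi> e A * D e A))"
    and "Am \<equiv> \<lambda>A. p * (\<Sum>e\<in>E. of_bool (e \<notin> A) * (\<psi> e A * D e A))"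
  shows "subset_expectation E p Ap = 1" and "subset_expectation E p Am = 1"
    and "\<bar>subset_expectation E p (\<lambda>A. of_bool (W A \<le> z)) - Phi z\<bar> \<le>
      subset_expectation E p (\<lambda>A. \<bar>Ap A - 1\<bar>) + subset_expectation E p (\<lambda>A. \<bar>Am A - 1\<bar>)"
proof -
  let ?E = "subset_expectation E p"
  define R where "R e A = \<psi> e A * D e A" for e A
  have \<psi>_eq: "\<psi> e (insert e A) = \<psi> e A" "\<psi> e (A - {e}) = \<psi> e A" if "e \<in> E" for e A
    using \<psi>_indep[OF that, of A] by (cases "e \<in> A"; simp add: insert_absorb)+
  have D_eq: "D e (insert e A) = D e A" "D e (A - {e}) = D e A" if "e \<in> E" "A \<subseteq> E" for e A
  proof -
    have "insert e A \<subseteq> E" "A - {e} \<subseteq> E" using that by auto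
    then show "D e (insert e A) = D e A" "D e (A - {e}) = D e A"
      using that by (simp_all add: D)
  qed
  have R_eq: "R e (insert e A) = R e A" "R e (A - {e}) = R e A" if "e \<in> E" "A \<subseteq> E" for e A
    using \<psi>_eq D_eq that by (simp_all add: R_def)
  \<comment> \<open>Evaluating \<open>g\<close> after \<open>e\<close> has been added amounts to
    restricting to sets containing \<open>e\<close>; one factor \<open>p\<close> is absorbed by the
    indicator. For removal of \<open>e\<close> the absorbed factor is \<open>1 - p\<close>.\<close>
  have in_E: "p * (1 - p) * ?E (\<lambda>A. R e A * g (insert e A)) =
      (1 - p) * ?E (\<lambda>A. of_bool (e \<in> A) * (R e A * g A))" if "e \<in> E" for e g
    using that R_eq by (subst subset_expectation_in[OF finite_E that]) (auto intro!: subset_expectation_cong)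
  have notin_E: "p * (1 - p) * ?E (\<lambda>A. R e A * g (A - {e})) =
      p * ?E (\<lambda>A. of_bool (e \<notin> A) * (R e A * g A))" if "e \<in> E" for e g
    using that R_eq by (subst subset_expectation_notin[OF finite_E that]) (auto intro!: subset_expectation_cong)
  have Ap: "(\<Sum>e\<in>E. p * (1 - p) * ?E (\<lambda>A. R e A * g (insert e A))) = ?E (\<lambda>A. Ap A * g A)" for g
  proof -
    have "(\<lambda>A. Ap A * g A) = (\<lambda>A. \<Sum>e\<in>E. (1 - p) * (of_bool (e \<in> A) * (R e A * g A)))"
      by (simp add: Ap_def R_def sum_distrib_left sum_distrib_right mult.assoc)
    then show ?thesis
      by (simp add: subset_expectation_sum subset_expectation_cmult in_E)
  qed
  have Am: "(\<Sum>e\<in>E. p * (1 - p) * ?E (\<lambda>A. R e A * g (A - {e}))) = ?E (\<lambda>A. Am A * g A)" for g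
  proof -
    have "(\<lambda>A. Am A * g A) = (\<lambda>A. \<Sum>e\<in>E. p * (of_bool (e \<notin> A) * (R e A * g A)))"
      by (simp add: Am_def R_def sum_distrib_left sum_distrib_right mult.assoc)
    then show ?thesis
      by (simp add: subset_expectation_sum subset_expectation_cmult notin_E)
  qed
  have cov: "?E (\<lambda>A. W A * H A) =
      (\<Sum>e\<in>E. p * (1 - p) * ?E (\<lambda>A. \<psi> e A * (H (insert e A) - H (A - {e}))))" for H
  proof -
    have "?E (\<lambda>A. W A * H A) = ?E (\<lambda>A. \<Sum>e\<in>E. (of_bool (e \<in> A) - p) * (\<psi> e A * H A))"
      by (intro subset_expectation_cong) (simp add: W sum_distrib_right mult.assoc)
    also have "\<dots> = (\<Sum>e\<in>E. p * (1 - p) *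
        ?E (\<lambda>A. \<psi> e (insert e A) * H (insert e A) - \<psi> e (A - {e}) * H (A - {e})))"
      unfolding subset_expectation_sum by (intro sum.cong refl subset_expectation_ibp)
    also have "\<dots> = (\<Sum>e\<in>E. p * (1 - p) * ?E (\<lambda>A. \<psi> e A * (H (insert e A) - H (A - {e}))))"
      by (simp add: \<psi>_eq right_diff_distrib)
    finally show ?thesis .
  qed
  have one: "1 = (\<Sum>e\<in>E. p * (1 - p) * ?E (R e))"
  proof -
    have "1 = ?E (\<lambda>A. W A * W A)"
      using W_var by (simp add: power2_eq_square)
    also have "\<dots> = (\<Sum>e\<in>E. p * (1 - p) * ?E (R e))"
      unfolding cov
      by (intro sum.cong refl arg_cong2[where f = "(*)"] subset_expectation_cong) (simp add: R_def D)
    finally show ?thesis .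
  qed
  show Ap1: "?E Ap = 1" using Ap[of "\<lambda>_. 1"] one by simp
  show Am1: "?E Am = 1" using Am[of "\<lambda>_. 1"] one by simp
  define G where "G A = W A * stein_sol z (W A)" for A
  define h where "h A = (of_bool (W A \<le> z) :: real)" for A
  have W_mono: "W (A - {e}) \<le> W (insert e A)" if "e \<in> E" "A \<subseteq> E" for e A
    using D[OF that] nonneg(2)[of e A] by linarith
  have "?E G = (\<Sum>e\<in>E. p * (1 - p) *
      ?E (\<lambda>A. \<psi> e A * (stein_sol z (W (insert e A)) - stein_sol z (W (A - {e})))))"
    using cov[of "\<lambda>A. stein_sol z (W A)"] by (simp add: G_def[abs_def])
  \<comment> \<open>In the upper estimate \<open>G\<close> sits at the upper end of each jump and is
    collected by \<open>Ap\<close>, while \<open>h\<close> sits at the lower end and is collected by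
    \<open>Am\<close>. In the lower estimate the two exchange roles.\<close>
  also have "\<dots> \<le> (\<Sum>e\<in>E. p * (1 - p) *
      ?E (\<lambda>A. R e A * G (insert e A) + R e A * h (A - {e}) - Phi z * R e A))"
  proof (intro sum_mono mult_left_mono subset_expectation_mono)
    fix e A assume eA: "e \<in> E" "A \<subseteq> E"
    have "\<psi> e A * (stein_sol z (W (insert e A)) - stein_sol z (W (A - {e})))
        \<le> \<psi> e A * (D e A * (G (insert e A) + h (A - {e}) - Phi z))"
      unfolding D[OF eA] G_def h_def
      by (intro mult_left_mono stein_sol_increment(2) W_mono eA nonneg)
    then show "\<psi> e A * (stein_sol z (W (insert e A)) - stein_sol z (W (A - {e})))
        \<le> R e A * G (insert e A) + R e A * h (A - {e}) - Phi z * R e A"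
      by (simp add: R_def algebra_simps)
  qed (use p01 in auto)
  also have "\<dots> = ?E (\<lambda>A. Ap A * G A) + ?E (\<lambda>A. Am A * h A) - Phi z * (\<Sum>e\<in>E. p * (1 - p) * ?E (R e))"
    unfolding Ap[symmetric] Am[symmetric]
    by (simp add: subset_expectation_add subset_expectation_diff subset_expectation_cmult
        distrib_left right_diff_distrib sum.distrib sum_subtractf sum_distrib_left mult_ac)
  finally have upper: "?E G \<le> ?E (\<lambda>A. Ap A * G A) + ?E (\<lambda>A. Am A * h A) - Phi z"
    using one by simp
  have "?E (\<lambda>A. Am A * G A) + ?E (\<lambda>A. Ap A * h A) - Phi z * (\<Sum>e\<in>E. p * (1 - p) * ?E (R e)) =
      (\<Sum>e\<in>E. p * (1 - p) *
      ?E (\<lambda>A. R e A * G (A - {e}) + R e A * h (insert e A) - Phi z * R e A))"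
    unfolding Ap[symmetric] Am[symmetric]
    by (simp add: subset_expectation_add subset_expectation_diff subset_expectation_cmult
        distrib_left right_diff_distrib sum.distrib sum_subtractf sum_distrib_left mult_ac)
  also have "\<dots> \<le> (\<Sum>e\<in>E. p * (1 - p) *
      ?E (\<lambda>A. \<psi> e A * (stein_sol z (W (insert e A)) - stein_sol z (W (A - {e})))))"
  proof (intro sum_mono mult_left_mono subset_expectation_mono)
    fix e A assume eA: "e \<in> E" "A \<subseteq> E"
    have "\<psi> e A * (D e A * (G (A - {e}) + h (insert e A) - Phi z))
        \<le> \<psi> e A * (stein_sol z (W (insert e A)) - stein_sol z (W (A - {e})))"
      unfolding D[OF eA] G_def h_def
      by (intro mult_left_mono stein_sol_increment(1) W_mono eA nonneg)
    then show "R e A * G (A - {e}) + R e A * h (insert e A) - Phi z * R e A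
        \<le> \<psi> e A * (stein_sol z (W (insert e A)) - stein_sol z (W (A - {e})))"
      by (simp add: R_def algebra_simps)
  qed (use p01 in auto)
  also have "\<dots> = ?E G"
    using cov[of "\<lambda>A. stein_sol z (W A)"] by (simp add: G_def[abs_def])
  finally have lower: "?E (\<lambda>A. Am A * G A) + ?E (\<lambda>A. Ap A * h A) - Phi z \<le> ?E G"
    using one by simp
  have small: "\<bar>?E (\<lambda>A. Q A * g A) - ?E g\<bar> \<le> ?E (\<lambda>A. \<bar>Q A - 1\<bar>)"
    if "\<And>A. \<bar>g A\<bar> \<le> 1" for Q g
  proof -
    have "\<bar>?E (\<lambda>A. Q A * g A) - ?E g\<bar> = \<bar>?E (\<lambda>A. (Q A - 1) * g A)\<bar>"
      by (simp add: subset_expectation_diff left_diff_distrib)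
    also have "\<dots> \<le> ?E (\<lambda>A. \<bar>(Q A - 1) * g A\<bar>)"
      by (rule subset_expectation_abs_le)
    also have "\<dots> \<le> ?E (\<lambda>A. \<bar>Q A - 1\<bar>)"
      by (intro subset_expectation_mono) (simp add: abs_mult that mult_left_le)
    finally show ?thesis .
  qed
  have bounded: "\<bar>G A\<bar> \<le> 1" "\<bar>h A\<bar> \<le> 1" for A
    by (simp_all add: G_def h_def stein_sol_mult_bound)
  have "\<bar>?E (\<lambda>A. Q A * G A) - ?E G\<bar> \<le> ?E (\<lambda>A. \<bar>Q A - 1\<bar>)"
    "\<bar>?E (\<lambda>A. Q A * h A) - ?E h\<bar> \<le> ?E (\<lambda>A. \<bar>Q A - 1\<bar>)" for Q
    by (intro small bounded)+
  \<comment> \<open>Replacing each weight by 1 costs its mean distance from 1, as \<open>G\<close>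
    and \<open>h\<close> are bounded by 1. The expectation of \<open>G\<close> then cancels and only
    that of \<open>h\<close> and \<open>Phi z\<close> remain.\<close>
  note this[of Ap] this[of Am]
  then have "\<bar>?E h - Phi z\<bar> \<le> ?E (\<lambda>A. \<bar>Ap A - 1\<bar>) + ?E (\<lambda>A. \<bar>Am A - 1\<bar>)"
    using upper lower by linarith
  then show "\<bar>?E (\<lambda>A. of_bool (W A \<le> z)) - Phi z\<bar> \<le>
      ?E (\<lambda>A. \<bar>Ap A - 1\<bar>) + ?E (\<lambda>A. \<bar>Am A - 1\<bar>)"
    by (simp add: h_def[abs_def])
qed

text \<open>Covariances of disjoint monomials vanish. In the others the factors
  \<open>p ^ k t\<close> pay for the elements of \<open>B t\<close> missing from \<open>A t\<close>,
  so each is at most \<open>p ^ card (B t \<union> B s)\<close>, times the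
  \<open>real m * (1 - p)\<close> that independence would cancel.\<close>

lemma variance_monomials_le:
  assumes "finite T" and sub: "\<And>t. t \<in> T \<Longrightarrow> A t \<subseteq> B t" "\<And>t. t \<in> T \<Longrightarrow> B t \<subseteq> E"
    and k: "\<And>t. t \<in> T \<Longrightarrow> card (B t - A t) \<le> k t" and m: "\<And>t. t \<in> T \<Longrightarrow> card (A t) \<le> m"
  defines "Y \<equiv> \<lambda>\<omega>. \<Sum>t\<in>T. p ^ k t * of_bool (A t \<subseteq> \<omega>)"
  shows "subset_expectation E p (\<lambda>\<omega>. (Y \<omega> - subset_expectation E p Y)\<^sup>2) \<le>
    real m * (1 - p) * (\<Sum>t\<in>T. \<Sum>s\<in>T. of_bool (B t \<inter> B s \<noteq> {}) * p ^ card (B t \<union> B s))"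
proof -
  let ?E = "subset_expectation E p"
  have EY: "?E Y = (\<Sum>t\<in>T. p ^ k t * p ^ card (A t))"
    unfolding Y_def subset_expectation_sum subset_expectation_cmult
    using sub by (intro sum.cong refl arg_cong2[where f = "(*)"] subset_expectation_subset finite_E) blast
  have "?E (\<lambda>\<omega>. (Y \<omega>)\<^sup>2) = ?E (\<lambda>\<omega>. \<Sum>t\<in>T. \<Sum>s\<in>T. p ^ k t * p ^ k s * of_bool (A t \<union> A s \<subseteq> \<omega>))"
    by (intro subset_expectation_cong)
      (auto simp: Y_def power2_eq_square sum_product intro!: sum.cong)
  also have "\<dots> = (\<Sum>t\<in>T. \<Sum>s\<in>T. p ^ k t * p ^ k s * p ^ card (A t \<union> A s))"
    unfolding subset_expectation_sum subset_expectation_cmult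
    using sub by (intro sum.cong refl arg_cong2[where f = "(*)"] subset_expectation_subset finite_E) blast
  finally have EY2: "?E (\<lambda>\<omega>. (Y \<omega>)\<^sup>2) = \<dots>" .
  have "?E (\<lambda>\<omega>. (Y \<omega> - ?E Y)\<^sup>2) = ?E (\<lambda>\<omega>. (Y \<omega>)\<^sup>2 - 2 * ?E Y * Y \<omega> + (?E Y)\<^sup>2)"
    by (intro subset_expectation_cong) (simp add: power2_diff mult_ac)
  also have "\<dots> = ?E (\<lambda>\<omega>. (Y \<omega>)\<^sup>2) - ?E Y * ?E Y"
    by (simp add: subset_expectation_add subset_expectation_diff subset_expectation_cmult
        subset_expectation_const[OF finite_E] power2_eq_square)
  also have "\<dots> = (\<Sum>t\<in>T. \<Sum>s\<in>T. p ^ k t * p ^ k s * p ^ card (A t \<union> A s)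
      - p ^ k t * p ^ card (A t) * (p ^ k s * p ^ card (A s)))"
    unfolding EY2 by (simp add: EY sum_product sum_subtractf)
  also have "\<dots> \<le> (\<Sum>t\<in>T. \<Sum>s\<in>T. real m * (1 - p) * (of_bool (B t \<inter> B s \<noteq> {}) * p ^ card (B t \<union> B s)))"
  proof (intro sum_mono)
    fix t s assume ts: "t \<in> T" "s \<in> T"
    have fin: "finite (A t)" "finite (A s)" "finite (B t)" "finite (B s)"
      using sub ts finite_E by (meson finite_subset)+
    have cards: "card (A t) + card (A s) = card (A t \<union> A s) + card (A t \<inter> A s)"
      by (rule card_Un_Int[OF fin(1,2)])
    show "p ^ k t * p ^ k s * p ^ card (A t \<union> A s) - p ^ k t * p ^ card (A t) * (p ^ k s * p ^ card (A s))
        \<le> real m * (1 - p) * (of_bool (B t \<inter> B s \<noteq> {}) * p ^ card (B t \<union> B s))"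
    proof (cases "B t \<inter> B s = {}")
      case True
      then have "A t \<inter> A s = {}" using sub ts by blast
      then show ?thesis
        using True cards by (simp add: power_add[symmetric] add_ac)
    next
      case False
      have "B t \<union> B s \<subseteq> A t \<union> A s \<union> (B t - A t) \<union> (B s - A s)" by blast
      then have "card (B t \<union> B s) \<le> card (A t \<union> A s \<union> (B t - A t) \<union> (B s - A s))"
        using fin by (intro card_mono) auto
      also have "\<dots> \<le> card (A t \<union> A s) + card (B t - A t) + card (B s - A s)"
        by (meson add_right_mono card_Un_le order_trans)
      finally have "card (B t \<union> B s) \<le> k t + k s + card (A t \<union> A s)"
        using k[OF ts(1)] k[OF ts(2)] by linarith
      then have le: "p ^ (k t + k s + card (A t \<union> A s)) \<le> p ^ card (B t \<union> B s)"
        using p01 by (intro power_decreasing) auto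
      \<comment> \<open>Bernoulli's inequality extracts the factor \<open>1 - p\<close>, which keeps
        the final bound sharp for \<open>p\<close> near 1.\<close>
      have "1 - real (card (A t \<inter> A s)) * (1 - p) \<le> p ^ card (A t \<inter> A s)"
        using Bernoulli_inequality[of "p - 1" "card (A t \<inter> A s)"] p01 by (simp add: algebra_simps)
      moreover have "card (A t \<inter> A s) \<le> m"
        using m[OF ts(1)] fin by (meson card_mono inf_le1 le_trans)
      then have "real (card (A t \<inter> A s)) * (1 - p) \<le> real m * (1 - p)"
        using p01 by (intro mult_right_mono) auto
      ultimately have "1 - p ^ card (A t \<inter> A s) \<le> real m * (1 - p)" by linarith
      moreover have "0 \<le> real m * (1 - p)" using p01 by simp
      ultimately have "p ^ (k t + k s + card (A t \<union> A s)) * (1 - p ^ card (A t \<inter> A s))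
          \<le> p ^ card (B t \<union> B s) * (real m * (1 - p))"
        using le p01 by (intro order_trans[OF mult_left_mono mult_right_mono]) auto
      moreover have "p ^ card (A t) * p ^ card (A s) = p ^ card (A t \<union> A s) * p ^ card (A t \<inter> A s)"
        by (simp add: cards flip: power_add)
      ultimately show ?thesis
        using False by (simp add: power_add right_diff_distrib mult_ac)
    qed
  qed
  finally show ?thesis
    by (simp add: sum_distrib_left)
qed

end

section \<open>Counting members of a family contained in a random subset\<close>

text \<open>The indicators are replaced by \<open>p\<close> one at a time, starting from the highest
  rank. In the summand of \<open>e\<close> the elements above are already replaced and those below
  are still random, so the factor beside the centred indicator does not involve \<open>e\<close>.
  The induction adds the element of highest rank last.\<close>

lemma prod_minus_power_telescope:
  fixes p :: real and rk :: "'e \<Rightarrow> nat"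
  assumes "finite a" "inj_on rk a"
  shows "of_bool (a \<subseteq> \<omega>) - p ^ card a =
    (\<Sum>e\<in>a. (of_bool (e \<in> \<omega>) - p) *
      (p ^ card {x\<in>a. rk e < rk x} * of_bool ({x\<in>a. rk x < rk e} \<subseteq> \<omega>)))"
  using assms
proof (induction a rule: finite_ranking_induct[where f = rk])
  case (insert x S)
  show ?case
  proof (cases "x \<in> S")
    case True
    then show ?thesis using insert by (simp add: insert_absorb)
  next
    case False
    have lt: "rk y < rk x" if "y \<in> S" for y
      using insert.hyps(2)[OF that] insert.prems that False
      by (metis insert_iff inj_onD order_le_imp_less_or_eq)
    have top: "{y \<in> insert x S. rk x < rk y} = {}" "{y \<in> insert x S. rk y < rk x} = S"
      using lt by force+
    have below: "{y \<in> insert x S. rk e < rk y} = insert x {y \<in> S. rk e < rk y}"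
      "{y \<in> insert x S. rk y < rk e} = {y \<in> S. rk y < rk e}" if "e \<in> S" for e
      using lt that by force+
    define g where "g S e = (of_bool (e \<in> \<omega>) - p) *
        (p ^ card {x\<in>S. rk e < rk x} * of_bool ({x\<in>S. rk x < rk e} \<subseteq> \<omega>))" for S e
    have gx: "g (insert x S) x = (of_bool (x \<in> \<omega>) - p) * of_bool (S \<subseteq> \<omega>)"
      unfolding g_def top by simp
    have ge: "g (insert x S) e = p * g S e" if "e \<in> S" for e
      unfolding g_def below[OF that] using insert.hyps False by simp
    have "(\<Sum>e\<in>insert x S. g (insert x S) e) =
        (of_bool (x \<in> \<omega>) - p) * of_bool (S \<subseteq> \<omega>) + p * (\<Sum>e\<in>S. g S e)"
      using insert.hyps False by (simp add: gx ge sum_distrib_left)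
    also have "\<dots> = (of_bool (x \<in> \<omega>) - p) * of_bool (S \<subseteq> \<omega>) + p * (of_bool (S \<subseteq> \<omega>) - p ^ card S)"
      using insert.IH insert.prems by (simp add: g_def)
    also have "\<dots> = of_bool (insert x S \<subseteq> \<omega>) - p ^ card (insert x S)"
      using insert.hyps False by (auto simp: algebra_simps)
    finally show ?thesis by (simp add: g_def)
  qed
qed simp

text \<open>The sum in \<open>glue\<close> is the conditional expectation, given that
  \<open>U\<close> is present, of the number of members that occur and meet \<open>U\<close>. The
  size \<open>3 * r\<close> allows for three members already glued together when the fourth is
  added.\<close>

locale edge_family =
  fixes E :: "'e set" and Fam :: "'e set set" and p :: real and r :: nat and L :: real
  assumes finite_E: "finite E" and p01: "0 < p" "p < 1"
    and Fam_sub: "\<And>a. a \<in> Fam \<Longrightarrow> a \<subseteq> E" and Fam_card: "\<And>a. a \<in> Fam \<Longrightarrow> card a = r"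
    and glue: "\<And>U. U \<subseteq> E \<Longrightarrow> card U \<le> 3 * r \<Longrightarrow>
      (\<Sum>a\<in>Fam. of_bool (a \<inter> U \<noteq> {}) * p ^ card (a - U)) \<le> L"
begin

definition N :: "'e set \<Rightarrow> real" where
  "N \<omega> = (\<Sum>a\<in>Fam. of_bool (a \<subseteq> \<omega>))"

abbreviation "expect \<equiv> subset_expectation E p"

definition "\<mu> = real (card Fam) * p ^ r"

definition "var_N = expect (\<lambda>\<omega>. (N \<omega> - \<mu>)\<^sup>2)"

lemma finite_Fam: "finite Fam"
  using Fam_sub finite_E by (meson Pow_iff finite_Pow_iff finite_subset subsetI)

lemma finite_member: "a \<in> Fam \<Longrightarrow> finite a"
  using Fam_sub finite_E finite_subset by blast

lemma expect_N: "expect N = \<mu>"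
proof -
  have "expect N = (\<Sum>a\<in>Fam. p ^ card a)"
    unfolding N_def[abs_def] subset_expectation_sum
    by (intro sum.cong refl subset_expectation_subset finite_E Fam_sub)
  then show ?thesis by (simp add: Fam_card \<mu>_def)
qed

lemma L_nonneg: "0 \<le> L"
  using glue[of "{}"] by simp

text \<open>These triples index the terms obtained when a sum over \<open>e\<close> of two member
  sums is multiplied out: one member from each factor and a common element.\<close>

abbreviation "T \<equiv> (SIGMA a:Fam. SIGMA b:Fam. a \<inter> b)"

lemma finite_T: "finite T"
  using finite_Fam finite_member by auto

lemma sum_T_le:
  fixes H :: "'e set \<Rightarrow> 'e set \<Rightarrow> real"
  assumes "\<And>a b. a \<in> Fam \<Longrightarrow> b \<in> Fam \<Longrightarrow> 0 \<le> H a b"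
  shows "(\<Sum>(a, b, e)\<in>T. H a b) \<le> r * (\<Sum>a\<in>Fam. \<Sum>b\<in>Fam. of_bool (a \<inter> b \<noteq> {}) * H a b)"
proof -
  have "(\<Sum>(a, b, e)\<in>T. H a b) = (\<Sum>a\<in>Fam. \<Sum>b\<in>Fam. card (a \<inter> b) * H a b)"
    using finite_Fam finite_member by (simp add: sum.Sigma[symmetric])
  also have "\<dots> \<le> (\<Sum>a\<in>Fam. \<Sum>b\<in>Fam. r * (of_bool (a \<inter> b \<noteq> {}) * H a b))"
  proof (intro sum_mono)
    fix a b assume ab: "a \<in> Fam" "b \<in> Fam"
    then have "card (a \<inter> b) \<le> r"
      using Fam_card finite_member by (metis card_mono inf_le1)
    then show "card (a \<inter> b) * H a b \<le> r * (of_bool (a \<inter> b \<noteq> {}) * H a b)"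
      using assms[OF ab] by (auto intro!: mult_right_mono)
  qed
  finally show ?thesis by (simp add: sum_distrib_left)
qed

text \<open>First \<open>a\<close> is glued onto \<open>U\<close>, then \<open>b\<close> onto
  \<open>U \<union> a\<close>; each gluing costs a factor \<open>L\<close>.\<close>

lemma glue_pair:
  assumes U: "U \<subseteq> E" "card U \<le> 2 * r"
  shows "(\<Sum>a\<in>Fam. \<Sum>b\<in>Fam. of_bool (a \<inter> U \<noteq> {}) * (of_bool (a \<inter> b \<noteq> {}) * p ^ card ((a \<union> b) - U))) \<le> L * L"
proof -
  have "(\<Sum>a\<in>Fam. \<Sum>b\<in>Fam. of_bool (a \<inter> U \<noteq> {}) * (of_bool (a \<inter> b \<noteq> {}) * p ^ card ((a \<union> b) - U)))
     \<le> (\<Sum>a\<in>Fam. \<Sum>b\<in>Fam. of_bool (a \<inter> U \<noteq> {}) * p ^ card (a - U) *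
        (of_bool (b \<inter> (U \<union> a) \<noteq> {}) * p ^ card (b - (U \<union> a))))"
  proof (intro sum_mono)
    fix a b assume ab: "a \<in> Fam" "b \<in> Fam"
    have "(a \<union> b) - U = (a - U) \<union> (b - (U \<union> a))" by blast
    then have "card ((a \<union> b) - U) = card (a - U) + card (b - (U \<union> a))"
      using finite_member ab by (simp add: card_Un_disjoint disjoint_iff)
    moreover have "of_bool (a \<inter> b \<noteq> {}) \<le> (of_bool (b \<inter> (U \<union> a) \<noteq> {}) :: real)"
      by auto
    ultimately show "of_bool (a \<inter> U \<noteq> {}) * (of_bool (a \<inter> b \<noteq> {}) * p ^ card ((a \<union> b) - U))
       \<le> of_bool (a \<inter> U \<noteq> {}) * p ^ card (a - U) *
        (of_bool (b \<inter> (U \<union> a) \<noteq> {}) * p ^ card (b - (U \<union> a)))"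
      using p01 by (auto simp: power_add)
  qed
  also have "\<dots> \<le> (\<Sum>a\<in>Fam. of_bool (a \<inter> U \<noteq> {}) * p ^ card (a - U) * L)"
    unfolding sum_distrib_left[symmetric]
  proof (intro sum_mono mult_left_mono glue)
    fix a assume a: "a \<in> Fam"
    then show "U \<union> a \<subseteq> E" using U Fam_sub by blast
    show "card (U \<union> a) \<le> 3 * r"
      using card_Un_le[of U a] U Fam_card[OF a] by simp
  qed (use p01 in auto)
  also have "\<dots> \<le> L * L"
    unfolding sum_distrib_right[symmetric] using U L_nonneg
    by (intro mult_right_mono glue) auto
  finally show ?thesis .
qed

text \<open>The first member contributes \<open>\<mu>\<close> and each of the three glued onto it a
  factor \<open>L\<close>. The common elements of the two triples give \<open>r ^ 2\<close>, and 2
  is for the choice of the member of the second pair that meets the first pair.\<close>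

lemma glue_quadruple:
  "(\<Sum>t\<in>T. \<Sum>s\<in>T. of_bool ((fst t \<union> fst (snd t)) \<inter> (fst s \<union> fst (snd s)) \<noteq> {}) *
      p ^ card ((fst t \<union> fst (snd t)) \<union> (fst s \<union> fst (snd s)))) \<le> 2 * real r ^ 2 * \<mu> * L ^ 3"
proof -
  have inner: "(\<Sum>s\<in>T. of_bool (U \<inter> (fst s \<union> fst (snd s)) \<noteq> {}) *
      p ^ card ((fst s \<union> fst (snd s)) - U)) \<le> 2 * r * L\<^sup>2" if U: "U \<subseteq> E" "card U \<le> 2 * r" for U
  proof -
    have "(\<Sum>s\<in>T. of_bool (U \<inter> (fst s \<union> fst (snd s)) \<noteq> {}) * p ^ card ((fst s \<union> fst (snd s)) - U)) =
      (\<Sum>(a, b, e)\<in>T. of_bool (U \<inter> (a \<union> b) \<noteq> {}) * p ^ card ((a \<union> b) - U))"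
      by (intro sum.cong) auto
    also have "\<dots> \<le> r * (\<Sum>a\<in>Fam. \<Sum>b\<in>Fam. of_bool (a \<inter> b \<noteq> {}) *
        (of_bool (U \<inter> (a \<union> b) \<noteq> {}) * p ^ card ((a \<union> b) - U)))"
      using p01 by (intro sum_T_le) auto
    \<comment> \<open>A union meets \<open>U\<close> only if one of its members does. The second
      summand is the first with \<open>a\<close> and \<open>b\<close> exchanged, so after swapping
      the sums \<open>glue_pair\<close> bounds both.\<close>
    also have "\<dots> \<le> r * (\<Sum>a\<in>Fam. \<Sum>b\<in>Fam.
        of_bool (a \<inter> U \<noteq> {}) * (of_bool (a \<inter> b \<noteq> {}) * p ^ card ((a \<union> b) - U)) +
        of_bool (b \<inter> U \<noteq> {}) * (of_bool (b \<inter> a \<noteq> {}) * p ^ card ((b \<union> a) - U)))"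
    proof (intro mult_left_mono sum_mono)
      fix a b :: "'e set"
      have "b \<union> a = a \<union> b" by auto
      then show "of_bool (a \<inter> b \<noteq> {}) * (of_bool (U \<inter> (a \<union> b) \<noteq> {}) * p ^ card ((a \<union> b) - U)) \<le>
        of_bool (a \<inter> U \<noteq> {}) * (of_bool (a \<inter> b \<noteq> {}) * p ^ card ((a \<union> b) - U)) +
        of_bool (b \<inter> U \<noteq> {}) * (of_bool (b \<inter> a \<noteq> {}) * p ^ card ((b \<union> a) - U))"
        using p01 by (auto simp: of_bool_def)
    qed auto
    also have "\<dots> = r * ((\<Sum>a\<in>Fam. \<Sum>b\<in>Fam.
        of_bool (a \<inter> U \<noteq> {}) * (of_bool (a \<inter> b \<noteq> {}) * p ^ card ((a \<union> b) - U))) +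
        (\<Sum>b\<in>Fam. \<Sum>a\<in>Fam. of_bool (b \<inter> U \<noteq> {}) * (of_bool (b \<inter> a \<noteq> {}) * p ^ card ((b \<union> a) - U))))"
      unfolding sum.distrib by (subst (4) sum.swap) (rule refl)
    also have "\<dots> \<le> r * (L * L + L * L)"
      using glue_pair[OF U] by (intro mult_left_mono add_mono) auto
    finally show ?thesis by (simp add: power2_eq_square)
  qed
  have "(\<Sum>t\<in>T. \<Sum>s\<in>T. of_bool ((fst t \<union> fst (snd t)) \<inter> (fst s \<union> fst (snd s)) \<noteq> {}) *
      p ^ card ((fst t \<union> fst (snd t)) \<union> (fst s \<union> fst (snd s)))) =
      (\<Sum>t\<in>T. p ^ card (fst t \<union> fst (snd t)) *
        (\<Sum>s\<in>T. of_bool ((fst t \<union> fst (snd t)) \<inter> (fst s \<union> fst (snd s)) \<noteq> {}) *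
        p ^ card ((fst s \<union> fst (snd s)) - (fst t \<union> fst (snd t)))))"
    unfolding sum_distrib_left
  proof (intro sum.cong refl)
    fix t s assume ts: "t \<in> T" "s \<in> T"
    let ?A = "fst t \<union> fst (snd t)" and ?B = "fst s \<union> fst (snd s)"
    have "finite ?A" "finite ?B"
      using ts finite_member by auto
    then have "card (?A \<union> ?B) = card ?A + card (?B - ?A)"
      by (metis Diff_disjoint Un_Diff_cancel card_Un_disjoint finite_Diff)
    then show "of_bool (?A \<inter> ?B \<noteq> {}) * p ^ card (?A \<union> ?B) =
      p ^ card ?A * (of_bool (?A \<inter> ?B \<noteq> {}) * p ^ card (?B - ?A))"
      by (simp add: power_add)
  qed
  also have "\<dots> \<le> (\<Sum>t\<in>T. p ^ card (fst t \<union> fst (snd t)) * (2 * r * L\<^sup>2))"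
  proof (intro sum_mono mult_left_mono inner)
    fix t assume t: "t \<in> T"
    then show "fst t \<union> fst (snd t) \<subseteq> E" using Fam_sub by fastforce
    show "card (fst t \<union> fst (snd t)) \<le> 2 * r"
      using t card_Un_le[of "fst t" "fst (snd t)"] Fam_card by auto
  qed (use p01 in auto)
  also have "\<dots> = (\<Sum>(a, b, e)\<in>T. p ^ card (a \<union> b)) * (2 * r * L\<^sup>2)"
    unfolding sum_distrib_right[symmetric] by (intro arg_cong2[where f = "(*)"] sum.cong) auto
  also have "\<dots> \<le> (r * (\<Sum>a\<in>Fam. \<Sum>b\<in>Fam. of_bool (a \<inter> b \<noteq> {}) * p ^ card (a \<union> b))) * (2 * r * L\<^sup>2)"
    using p01 by (intro mult_right_mono sum_T_le) auto
  also have "\<dots> \<le> (r * (\<mu> * L)) * (2 * r * L\<^sup>2)"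
  proof (intro mult_right_mono mult_left_mono)
    have "(\<Sum>a\<in>Fam. \<Sum>b\<in>Fam. of_bool (a \<inter> b \<noteq> {}) * p ^ card (a \<union> b)) =
      (\<Sum>a\<in>Fam. p ^ r * (\<Sum>b\<in>Fam. of_bool (b \<inter> a \<noteq> {}) * p ^ card (b - a)))"
      unfolding sum_distrib_left
    proof (intro sum.cong refl)
      fix a b assume ab: "a \<in> Fam" "b \<in> Fam"
      then have "card (a \<union> b) = card a + card (b - a)"
        using finite_member by (metis Diff_disjoint Un_Diff_cancel card_Un_disjoint finite_Diff)
      then show "of_bool (a \<inter> b \<noteq> {}) * p ^ card (a \<union> b) =
          p ^ r * (of_bool (b \<inter> a \<noteq> {}) * p ^ card (b - a))"
        using ab by (simp add: power_add Fam_card Int_commute)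
    qed
    also have "\<dots> \<le> (\<Sum>a\<in>Fam. p ^ r * L)"
      using p01 Fam_sub Fam_card by (intro sum_mono mult_left_mono glue) auto
    finally show "(\<Sum>a\<in>Fam. \<Sum>b\<in>Fam. of_bool (a \<inter> b \<noteq> {}) * p ^ card (a \<union> b)) \<le> \<mu> * L"
      by (simp add: \<mu>_def)
  qed (use L_nonneg in auto)
  finally show ?thesis
    by (simp add: power2_eq_square power3_eq_cube mult_ac)
qed

section \<open>Stein's bound for the number of members present\<close>

lemmas expect_mono = subset_expectation_mono[OF finite_E p01]
lemmas expect_abs_le_sqrt = subset_expectation_abs_le_sqrt[OF finite_E p01]

lemma expect_nonneg: "(\<And>\<omega>. 0 \<le> F \<omega>) \<Longrightarrow> 0 \<le> expect F"
  using expect_mono[of "\<lambda>_. 0" F] by (simp add: subset_expectation_const[OF finite_E])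

lemma sum_E_eq_sum_T:
  "(\<Sum>e\<in>E. (\<Sum>a\<in>Fam. of_bool (e \<in> a) * f a e) * (\<Sum>b\<in>Fam. of_bool (e \<in> b) * g b e)) =
    (\<Sum>(a, b, e)\<in>T. f a e * g b e :: real)"
proof -
  have "(\<Sum>e\<in>E. (\<Sum>a\<in>Fam. of_bool (e \<in> a) * f a e) * (\<Sum>b\<in>Fam. of_bool (e \<in> b) * g b e)) =
      (\<Sum>e\<in>E. \<Sum>a\<in>Fam. \<Sum>b\<in>Fam. of_bool (e \<in> a \<inter> b) * (f a e * g b e))"
    unfolding sum_product by (intro sum.cong refl) auto
  also have "\<dots> = (\<Sum>a\<in>Fam. \<Sum>e\<in>E. \<Sum>b\<in>Fam. of_bool (e \<in> a \<inter> b) * (f a e * g b e))"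
    by (rule sum.swap)
  also have "\<dots> = (\<Sum>a\<in>Fam. \<Sum>b\<in>Fam. \<Sum>e\<in>E. of_bool (e \<in> a \<inter> b) * (f a e * g b e))"
    by (intro sum.cong refl sum.swap)
  also have "\<dots> = (\<Sum>a\<in>Fam. \<Sum>b\<in>Fam. \<Sum>e\<in>a \<inter> b. f a e * g b e)"
  proof (rule sum.cong[OF refl], rule sum.cong[OF refl])
    fix a b assume "a \<in> Fam" "b \<in> Fam"
    then have "a \<inter> b \<subseteq> E" using Fam_sub by blast
    then show "(\<Sum>e\<in>E. of_bool (e \<in> a \<inter> b) * (f a e * g b e)) = (\<Sum>e\<in>a \<inter> b. f a e * g b e)"
      using finite_E by (intro sum.mono_neutral_cong_right) auto
  qed
  also have "\<dots> = (\<Sum>(a, b, e)\<in>T. f a e * g b e)"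
    using finite_Fam finite_member by (simp add: sum.Sigma)
  finally show ?thesis .
qed

text \<open>This is \<open>variance_monomials_le\<close> with
  \<open>B (a, b, e) = a \<union> b\<close>, a set of at most \<open>2 * r\<close> elements; the
  constant is the product of \<open>2 * r\<close> and the \<open>2 * r ^ 2\<close> of
  \<open>glue_quadruple\<close>.\<close>

lemma variance_T_le:
  assumes sub: "\<And>a b e. (a, b, e) \<in> T \<Longrightarrow> A (a, b, e) \<subseteq> a \<union> b"
    and k: "\<And>a b e. (a, b, e) \<in> T \<Longrightarrow> card ((a \<union> b) - A (a, b, e)) \<le> k (a, b, e)"
  defines "Y \<equiv> \<lambda>\<omega>. \<Sum>t\<in>T. p ^ k t * of_bool (A t \<subseteq> \<omega>)"
  shows "expect (\<lambda>\<omega>. (Y \<omega> - expect Y)\<^sup>2) \<le> 4 * (real r ^ 3 * (1 - p) * \<mu> * L ^ 3)"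
proof -
  have card_le: "card (A t) \<le> 2 * r" if "t \<in> T" for t
  proof -
    obtain a b e where t: "t = (a, b, e)" by (cases t)
    have "card (A t) \<le> card (a \<union> b)"
      using sub[of a b e] that t finite_member by (intro card_mono) auto
    also have "\<dots> \<le> 2 * r"
      using card_Un_le[of a b] that t Fam_card by auto
    finally show ?thesis .
  qed
  have "expect (\<lambda>\<omega>. (Y \<omega> - expect Y)\<^sup>2) \<le> real (2 * r) * (1 - p) *
      (\<Sum>t\<in>T. \<Sum>s\<in>T. of_bool ((fst t \<union> fst (snd t)) \<inter> (fst s \<union> fst (snd s)) \<noteq> {}) *
      p ^ card ((fst t \<union> fst (snd t)) \<union> (fst s \<union> fst (snd s))))"
    unfolding Y_def
  proof (rule variance_monomials_le[OF finite_E p01 finite_T])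
    fix t assume t: "t \<in> T"
    obtain a b e where abe: "t = (a, b, e)" by (cases t)
    show "A t \<subseteq> fst t \<union> fst (snd t)" "card (fst t \<union> fst (snd t) - A t) \<le> k t"
      using sub[of a b e] k[of a b e] t abe by auto
    show "fst t \<union> fst (snd t) \<subseteq> E" using t Fam_sub by fastforce
  qed (rule card_le)
  also have "\<dots> \<le> real (2 * r) * (1 - p) * (2 * real r ^ 2 * \<mu> * L ^ 3)"
    using p01 by (intro mult_left_mono glue_quadruple) auto
  finally show ?thesis
    by (simp add: power2_eq_square power3_eq_cube algebra_simps)
qed

text \<open>After telescoping, both weights of \<open>stein_kolmogorov_bound\<close> are
  combinations of monomials indexed by \<open>T\<close>, so their mean distances from 1 are
  controlled by the variance bound over quadruples.\<close>

theorem count_kolmogorov_bound: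
  assumes var_pos: "0 < var_N"
  shows "\<bar>expect (\<lambda>\<omega>. of_bool ((N \<omega> - \<mu>) / sqrt var_N \<le> z)) - Phi z\<bar> \<le>
    6 * sqrt (real r ^ 3 * (1 - p) * \<mu> * L ^ 3) / var_N"
proof -
  \<comment> \<open>Any injective ranking serves; it only fixes the order of the
    telescoping.\<close>
  obtain rk :: "'e \<Rightarrow> nat" where rk: "inj_on rk E"
    using finite_imp_inj_to_nat_seg[OF finite_E] by auto
  define below where "below a e = {x\<in>a. rk x < rk e}" for a e
  define above where "above a e = {x\<in>a. rk e < rk x}" for a e
  \<comment> \<open>\<open>\<psi> e\<close> collects the telescoping coefficients of
    \<open>e\<close> over all members; \<open>D e\<close> counts the members through
    \<open>e\<close> whose other elements are present, which is the jump of
    \<open>N\<close>.\<close>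
  define \<psi> where "\<psi> e \<omega> = (\<Sum>a\<in>Fam. of_bool (e \<in> a) * (p ^ card (above a e) * of_bool (below a e \<subseteq> \<omega>)))" for e \<omega>
  define D where "D e \<omega> = (\<Sum>b\<in>Fam. of_bool (e \<in> b) * of_bool (b - {e} \<subseteq> \<omega>) :: real)" for e \<omega>
  have N_eq: "N \<omega> - \<mu> = (\<Sum>e\<in>E. (of_bool (e \<in> \<omega>) - p) * \<psi> e \<omega>)" for \<omega>
  proof -
    have "N \<omega> - \<mu> = (\<Sum>a\<in>Fam. of_bool (a \<subseteq> \<omega>) - p ^ card a)"
      by (simp add: N_def \<mu>_def sum_subtractf Fam_card)
    also have "\<dots> = (\<Sum>a\<in>Fam. \<Sum>e\<in>E. of_bool (e \<in> a) * ((of_bool (e \<in> \<omega>) - p) *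
        (p ^ card (above a e) * of_bool (below a e \<subseteq> \<omega>))))"
    proof (intro sum.cong refl)
      fix a assume a: "a \<in> Fam"
      have "of_bool (a \<subseteq> \<omega>) - p ^ card a = (\<Sum>e\<in>a. (of_bool (e \<in> \<omega>) - p) *
          (p ^ card (above a e) * of_bool (below a e \<subseteq> \<omega>)))"
        unfolding above_def below_def
        by (rule prod_minus_power_telescope[OF finite_member[OF a] inj_on_subset[OF rk Fam_sub[OF a]]])
      also have "\<dots> = (\<Sum>e\<in>E. of_bool (e \<in> a) * ((of_bool (e \<in> \<omega>) - p) *
        (p ^ card (above a e) * of_bool (below a e \<subseteq> \<omega>))))"
        using finite_E Fam_sub[OF a] by (intro sum.mono_neutral_cong_left) auto
      finally show "of_bool (a \<subseteq> \<omega>) - p ^ card a = (\<Sum>e\<in>E. of_bool (e \<in> a) * ((of_bool (e \<in> \<omega>) - p) *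
        (p ^ card (above a e) * of_bool (below a e \<subseteq> \<omega>))))" .
    qed
    also have "\<dots> = (\<Sum>e\<in>E. (of_bool (e \<in> \<omega>) - p) * \<psi> e \<omega>)"
      unfolding \<psi>_def sum_distrib_left by (subst sum.swap) (simp add: mult_ac)
    finally show ?thesis .
  qed
  have D_eq: "D e \<omega> = N (insert e \<omega>) - N (\<omega> - {e})" for e \<omega>
    unfolding D_def N_def sum_subtractf[symmetric] by (intro sum.cong refl) (auto simp: of_bool_def)
  have \<psi>_indep: "\<psi> e (insert e \<omega>) = \<psi> e (\<omega> - {e})" for e \<omega>
    unfolding \<psi>_def by (intro sum.cong refl arg_cong2[where f = "(*)"] arg_cong[where f = of_bool])
      (auto simp: below_def)
  define v where "v = var_N"
  have v: "0 < v" using var_pos by (simp add: v_def)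
  define A1 where "A1 = (\<lambda>(a, b, e). below a e \<union> b)"
  define A0 where "A0 = (\<lambda>(a, b, e). below a e \<union> (b - {e}))"
  define k1 where "k1 = (\<lambda>(a, b :: 'e set, e). card (above a e))"
  define k0 where "k0 = (\<lambda>(a, b :: 'e set, e). Suc (card (above a e)))"
  define Y1 where "Y1 \<omega> = (\<Sum>t\<in>T. p ^ k1 t * of_bool (A1 t \<subseteq> \<omega>))" for \<omega>
  define Y0 where "Y0 \<omega> = (\<Sum>t\<in>T. p ^ k0 t * of_bool (A0 t \<subseteq> \<omega>))" for \<omega>
  have Y1_eq: "(\<Sum>e\<in>E. of_bool (e \<in> \<omega>) * (\<psi> e \<omega> * D e \<omega>)) = Y1 \<omega>" for \<omega>
  proof -
    have "(\<Sum>e\<in>E. of_bool (e \<in> \<omega>) * (\<psi> e \<omega> * D e \<omega>)) =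
        (\<Sum>e\<in>E. (\<Sum>a\<in>Fam. of_bool (e \<in> a) * (p ^ card (above a e) * of_bool (below a e \<subseteq> \<omega>))) *
          (\<Sum>b\<in>Fam. of_bool (e \<in> b) * of_bool (b \<subseteq> \<omega>)))"
    proof (intro sum.cong refl)
      fix e
      have "of_bool (e \<in> \<omega>) * D e \<omega> = (\<Sum>b\<in>Fam. of_bool (e \<in> b) * of_bool (b \<subseteq> \<omega>))"
        unfolding D_def sum_distrib_left by (intro sum.cong refl) (auto simp: of_bool_def)
      then have "\<psi> e \<omega> * (of_bool (e \<in> \<omega>) * D e \<omega>) =
          (\<Sum>a\<in>Fam. of_bool (e \<in> a) * (p ^ card (above a e) * of_bool (below a e \<subseteq> \<omega>))) *
          (\<Sum>b\<in>Fam. of_bool (e \<in> b) * of_bool (b \<subseteq> \<omega>))"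
        by (simp only: \<psi>_def)
      then show "of_bool (e \<in> \<omega>) * (\<psi> e \<omega> * D e \<omega>) =
          (\<Sum>a\<in>Fam. of_bool (e \<in> a) * (p ^ card (above a e) * of_bool (below a e \<subseteq> \<omega>))) *
          (\<Sum>b\<in>Fam. of_bool (e \<in> b) * of_bool (b \<subseteq> \<omega>))"
        by (simp only: mult.left_commute[of "\<psi> e \<omega>"])
    qed
    also have "\<dots> = Y1 \<omega>"
      unfolding sum_E_eq_sum_T Y1_def
      by (intro sum.cong refl) (clarsimp simp: k1_def A1_def of_bool_conj)
    finally show ?thesis .
  qed
  have Y0_eq: "p * (\<Sum>e\<in>E. \<psi> e \<omega> * D e \<omega>) = Y0 \<omega>" for \<omega>
  proof -
    have "(\<Sum>e\<in>E. \<psi> e \<omega> * D e \<omega>) =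
        (\<Sum>(a, b, e)\<in>T. p ^ card (above a e) * of_bool (below a e \<subseteq> \<omega>) * of_bool (b - {e} \<subseteq> \<omega>))"
      unfolding \<psi>_def D_def by (rule sum_E_eq_sum_T)
    also have "p * \<dots> = Y0 \<omega>"
      unfolding Y0_def sum_distrib_left
      by (intro sum.cong refl) (clarsimp simp: k0_def A0_def of_bool_conj)
    finally show ?thesis .
  qed
  \<comment> \<open>The absence of \<open>e\<close> is written as 1 minus its presence, so that only
    increasing monomials occur.\<close>
  have Y0_eq': "p * (\<Sum>e\<in>E. of_bool (e \<notin> \<omega>) * (\<psi> e \<omega> * D e \<omega>)) = Y0 \<omega> - p * Y1 \<omega>" for \<omega>
  proof -
    have "(\<Sum>e\<in>E. of_bool (e \<notin> \<omega>) * (\<psi> e \<omega> * D e \<omega>)) =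
        (\<Sum>e\<in>E. \<psi> e \<omega> * D e \<omega>) - (\<Sum>e\<in>E. of_bool (e \<in> \<omega>) * (\<psi> e \<omega> * D e \<omega>))"
      unfolding sum_subtractf[symmetric] by (intro sum.cong refl) auto
    then show ?thesis
      using Y0_eq[of \<omega>] Y1_eq[of \<omega>] by (simp add: right_diff_distrib)
  qed
  define X where "X = real r ^ 3 * (1 - p) * \<mu> * L ^ 3"
  \<comment> \<open>The elements of \<open>a \<union> b\<close> missing from the monomials lie above
    \<open>e\<close> in \<open>a\<close>, apart from \<open>e\<close> itself for \<open>A0\<close>.
    Distinct ranks exclude any other element at the rank of \<open>e\<close>.\<close>
  have rest: "a \<union> b - A1 (a, b, e) \<subseteq> above a e" "a \<union> b - A0 (a, b, e) \<subseteq> insert e (above a e)"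
      "finite (above a e)" if "(a, b, e) \<in> T" for a b e
  proof -
    have ab: "a \<in> Fam" "e \<in> a" "e \<in> b" using that by auto
    then have "x = e" if "x \<in> a" "rk x = rk e" for x
      using that Fam_sub[OF ab(1)] rk by (meson inj_onD subsetD)
    then show "a \<union> b - A1 (a, b, e) \<subseteq> above a e" "a \<union> b - A0 (a, b, e) \<subseteq> insert e (above a e)"
      using ab by (fastforce simp: A1_def A0_def above_def below_def)+
    show "finite (above a e)"
      using finite_member[OF ab(1)] by (simp add: above_def)
  qed
  have V1: "expect (\<lambda>\<omega>. (Y1 \<omega> - expect Y1)\<^sup>2) \<le> 4 * X"
    unfolding Y1_def X_def
  proof (rule variance_T_le)
    fix a b e assume t: "(a, b, e) \<in> T"
    show "A1 (a, b, e) \<subseteq> a \<union> b" by (auto simp: A1_def below_def)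
    show "card (a \<union> b - A1 (a, b, e)) \<le> k1 (a, b, e)"
      using rest[OF t] by (simp add: k1_def card_mono)
  qed
  have V0: "expect (\<lambda>\<omega>. (Y0 \<omega> - expect Y0)\<^sup>2) \<le> 4 * X"
    unfolding Y0_def X_def
  proof (rule variance_T_le)
    fix a b e assume t: "(a, b, e) \<in> T"
    show "A0 (a, b, e) \<subseteq> a \<union> b" by (auto simp: A0_def below_def)
    have "card (a \<union> b - A0 (a, b, e)) \<le> card (insert e (above a e))"
      using rest[OF t] by (intro card_mono) auto
    also have "\<dots> \<le> k0 (a, b, e)"
      using rest[OF t] by (simp add: k0_def card_insert_le_m1 card_insert_if)
    finally show "card (a \<union> b - A0 (a, b, e)) \<le> k0 (a, b, e)" .
  qed
  define W where "W \<omega> = (N \<omega> - \<mu>) / sqrt v" for \<omega>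
  define Ap where "Ap \<omega> = (1 - p) * (\<Sum>e\<in>E. of_bool (e \<in> \<omega>) * (\<psi> e \<omega> / sqrt v * (D e \<omega> / sqrt v)))" for \<omega>
  define Am where "Am \<omega> = p * (\<Sum>e\<in>E. of_bool (e \<notin> \<omega>) * (\<psi> e \<omega> / sqrt v * (D e \<omega> / sqrt v)))" for \<omega>
  have prems: "\<And>\<omega>. \<omega> \<subseteq> E \<Longrightarrow> W \<omega> = (\<Sum>e\<in>E. (of_bool (e \<in> \<omega>) - p) * (\<psi> e \<omega> / sqrt v))"
    "\<And>e \<omega>. e \<in> E \<Longrightarrow> \<psi> e (insert e \<omega>) / sqrt v = \<psi> e (\<omega> - {e}) / sqrt v"
    "\<And>e \<omega>. e \<in> E \<Longrightarrow> \<omega> \<subseteq> E \<Longrightarrow> D e \<omega> / sqrt v = W (insert e \<omega>) - W (\<omega> - {e})"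
    "\<And>e \<omega>. 0 \<le> \<psi> e \<omega> / sqrt v" "\<And>e \<omega>. 0 \<le> D e \<omega> / sqrt v"
    "expect (\<lambda>\<omega>. (W \<omega>)\<^sup>2) = 1"
  proof -
    show "W \<omega> = (\<Sum>e\<in>E. (of_bool (e \<in> \<omega>) - p) * (\<psi> e \<omega> / sqrt v))" for \<omega>
      by (simp add: W_def N_eq sum_divide_distrib)
    show "D e \<omega> / sqrt v = W (insert e \<omega>) - W (\<omega> - {e})" for e \<omega>
      by (simp add: D_eq W_def diff_divide_distrib)
    show "0 \<le> \<psi> e \<omega> / sqrt v" "0 \<le> D e \<omega> / sqrt v" for e \<omega>
      using v p01 by (auto simp: \<psi>_def D_def intro!: divide_nonneg_nonneg sum_nonneg)
    have "expect (\<lambda>\<omega>. (W \<omega>)\<^sup>2) = expect (\<lambda>\<omega>. 1 / v * (N \<omega> - \<mu>)\<^sup>2)"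
      using v by (simp add: W_def power_divide)
    also have "\<dots> = 1"
      using v unfolding subset_expectation_cmult by (simp add: v_def var_N_def)
    finally show "expect (\<lambda>\<omega>. (W \<omega>)\<^sup>2) = 1" .
  qed (simp add: \<psi>_indep)
  note stein = stein_kolmogorov_bound[OF finite_E p01 prems, folded Ap_def Am_def]
  have scale: "(\<Sum>e\<in>E. f e * (\<psi> e \<omega> / sqrt v * (D e \<omega> / sqrt v))) =
      (\<Sum>e\<in>E. f e * (\<psi> e \<omega> * D e \<omega>)) / v" for f :: "'e \<Rightarrow> real" and \<omega>
    using v by (simp add: sum_divide_distrib)
  have Ap_eq: "Ap \<omega> = (1 - p) / v * Y1 \<omega>" for \<omega>
    unfolding Ap_def scale Y1_eq by simp
  have Am_eq: "Am \<omega> = 1 / v * (Y0 \<omega> - p * Y1 \<omega>)" for \<omega>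
    unfolding Am_def scale using Y0_eq'[of \<omega>] by simp
  have "(1 - p) / v * expect Y1 = expect (\<lambda>\<omega>. (1 - p) / v * Y1 \<omega>)"
    by (simp only: subset_expectation_cmult)
  also have "\<dots> = 1"
    using stein(1) by (simp add: Ap_eq[abs_def])
  finally have EY1: "(1 - p) / v * expect Y1 = 1" .
  have "1 / v * (expect Y0 - p * expect Y1) = expect (\<lambda>\<omega>. 1 / v * (Y0 \<omega> - p * Y1 \<omega>))"
    by (simp only: subset_expectation_cmult subset_expectation_diff)
  also have "\<dots> = 1"
    using stein(2) by (simp add: Am_eq[abs_def])
  finally have EY0: "1 / v * (expect Y0 - p * expect Y1) = 1" .
  have X: "0 \<le> X"
    using p01 L_nonneg by (simp add: X_def \<mu>_def)
  \<comment> \<open>As \<open>Ap\<close> has mean 1, \<open>Ap - 1\<close> is a multiple of the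
    centred \<open>Y1\<close>. Its coefficient is at most \<open>1 / v\<close>, which leads to the
    share 2 of the final constant 6.\<close>
  have "expect (\<lambda>\<omega>. (Ap \<omega> - 1)\<^sup>2) = expect (\<lambda>\<omega>. ((1 - p) / v)\<^sup>2 * (Y1 \<omega> - expect Y1)\<^sup>2)"
  proof (intro subset_expectation_cong)
    fix \<omega>
    have "Ap \<omega> - 1 = (1 - p) / v * (Y1 \<omega> - expect Y1)"
      unfolding right_diff_distrib EY1 Ap_eq ..
    then show "(Ap \<omega> - 1)\<^sup>2 = ((1 - p) / v)\<^sup>2 * (Y1 \<omega> - expect Y1)\<^sup>2"
      by (simp only: power_mult_distrib)
  qed
  also have "\<dots> \<le> (1 / v)\<^sup>2 * (4 * X)"
    unfolding subset_expectation_cmult using V1 v p01 expect_nonneg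
    by (intro mult_mono power_mono divide_right_mono) auto
  finally have "expect (\<lambda>\<omega>. \<bar>Ap \<omega> - 1\<bar>) \<le> sqrt ((1 / v)\<^sup>2 * (4 * X))"
    using expect_abs_le_sqrt[of "\<lambda>\<omega>. Ap \<omega> - 1"] by (meson order_trans real_sqrt_le_iff)
  then have dp: "expect (\<lambda>\<omega>. \<bar>Ap \<omega> - 1\<bar>) \<le> 2 * sqrt X / v"
    using v by (simp add: real_sqrt_mult real_sqrt_divide)
  \<comment> \<open>From the square of a difference one gets twice each variance, so 16 times
    \<open>X\<close> in all and the remaining share 4 of the constant 6.\<close>
  have "expect (\<lambda>\<omega>. (Am \<omega> - 1)\<^sup>2) \<le>
      expect (\<lambda>\<omega>. (1 / v)\<^sup>2 * (2 * (Y0 \<omega> - expect Y0)\<^sup>2 + 2 * (Y1 \<omega> - expect Y1)\<^sup>2))"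
  proof (intro expect_mono)
    fix \<omega>
    define x y where "x = Y0 \<omega> - expect Y0" and "y = Y1 \<omega> - expect Y1"
    have "(x - p * y)\<^sup>2 + (x + p * y)\<^sup>2 = 2 * x\<^sup>2 + 2 * (p\<^sup>2 * y\<^sup>2)"
      by (simp add: power2_eq_square algebra_simps)
    moreover have "p\<^sup>2 * y\<^sup>2 \<le> 1 * y\<^sup>2"
      using p01 by (intro mult_right_mono) (auto simp: power_le_one)
    moreover have "0 \<le> (x + p * y)\<^sup>2" by simp
    ultimately have le: "(x - p * y)\<^sup>2 \<le> 2 * x\<^sup>2 + 2 * y\<^sup>2" by linarith
    have "Am \<omega> - 1 = 1 / v * (Y0 \<omega> - p * Y1 \<omega>) - 1 / v * (expect Y0 - p * expect Y1)"
      unfolding EY0 Am_eq ..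
    also have "\<dots> = 1 / v * (x - p * y)"
      by (simp only: x_def y_def right_diff_distrib[symmetric]) (simp add: algebra_simps)
    finally have "(Am \<omega> - 1)\<^sup>2 = (1 / v)\<^sup>2 * (x - p * y)\<^sup>2"
      by (simp only: power_mult_distrib)
    also have "\<dots> \<le> (1 / v)\<^sup>2 * (2 * x\<^sup>2 + 2 * y\<^sup>2)"
      using le by (intro mult_left_mono) auto
    finally show "(Am \<omega> - 1)\<^sup>2 \<le> (1 / v)\<^sup>2 * (2 * (Y0 \<omega> - expect Y0)\<^sup>2 + 2 * (Y1 \<omega> - expect Y1)\<^sup>2)"
      by (simp only: x_def y_def)
  qed
  also have "\<dots> = (1 / v)\<^sup>2 * (2 * expect (\<lambda>\<omega>. (Y0 \<omega> - expect Y0)\<^sup>2) + 2 * expect (\<lambda>\<omega>. (Y1 \<omega> - expect Y1)\<^sup>2))"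
    by (simp only: subset_expectation_cmult subset_expectation_add)
  also have "\<dots> \<le> (1 / v)\<^sup>2 * (16 * X)"
    using V0 V1 by (intro mult_left_mono) auto
  finally have "expect (\<lambda>\<omega>. \<bar>Am \<omega> - 1\<bar>) \<le> sqrt ((1 / v)\<^sup>2 * (16 * X))"
    using expect_abs_le_sqrt[of "\<lambda>\<omega>. Am \<omega> - 1"] by (meson order_trans real_sqrt_le_iff)
  then have dm: "expect (\<lambda>\<omega>. \<bar>Am \<omega> - 1\<bar>) \<le> 4 * sqrt X / v"
    using v by (simp add: real_sqrt_mult real_sqrt_divide)
  have "\<bar>expect (\<lambda>\<omega>. of_bool (W \<omega> \<le> z)) - Phi z\<bar> \<le> 6 * sqrt X / v"
    using stein(3)[of z] dp dm by (simp add: add_divide_distrib[symmetric]) 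
  then show ?thesis
    by (simp add: W_def[abs_def] v_def X_def)
qed

end

section \<open>Cycles in complete graphs\<close>

definition cycle_edges :: "nat \<Rightarrow> nat set set" where
  "cycle_edges r = (\<lambda>i. {i, Suc i mod r}) ` {..<r}"

lemma cycle_graph_eq: "cycle_graph r = ({..<r}, cycle_edges r)"
  by (auto simp: cycle_graph_def cycle_edges_def)

lemma cycle_successor_closed:
  assumes "J \<subseteq> {..<r}" "J \<noteq> {}" "\<And>i. i \<in> J \<Longrightarrow> Suc i mod r \<in> J"
  shows "J = {..<r}"
proof -
  obtain j where j: "j \<in> J" using assms by blast
  then have "j < r" using assms by blast
  have step: "(j + k) mod r \<in> J" for k
  proof (induction k)
    case 0
    then show ?case using j \<open>j < r\<close> by simp
  next
    case (Suc k)
    then show ?case using assms(3)[OF Suc] by (simp add: mod_Suc_eq)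
  qed
  have "i \<in> J" if "i < r" for i
  proof -
    \<comment> \<open>\<open>r - j + i\<close> steps lead from \<open>j\<close> once past 0 and on
      to \<open>i\<close>, without subtracting beyond 0.\<close>
    have "(j + (r - j + i)) mod r = i" using \<open>j < r\<close> that by simp
    then show ?thesis using step by metis
  qed
  then show ?thesis using assms(1) by auto
qed

context
  fixes r :: nat
  assumes r: "r \<ge> 3"
begin

lemma Suc_mod_neq: "i < r \<Longrightarrow> Suc i mod r \<noteq> i"
  using r by (auto simp: mod_Suc split: if_splits)

text \<open>Two different positions with the same edge would be each other's successors, which
  happens only on a cycle of length 2.\<close>

lemma inj_on_cycle_edge: "inj_on (\<lambda>i. {i, Suc i mod r}) {..<r}"
proof (rule inj_onI)
  fix i j assume ij: "i \<in> {..<r}" "j \<in> {..<r}" and eq: "{i, Suc i mod r} = {j, Suc j mod r}"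
  show "i = j"
  proof (rule ccontr)
    assume "i \<noteq> j"
    then have "i = Suc j mod r" "j = Suc i mod r" using eq by (auto simp: doubleton_eq_iff)
    moreover have "Suc k mod r = (if Suc k = r then 0 else Suc k)" if "k < r" for k
      using that by auto
    ultimately show False using ij r by (auto split: if_splits)
  qed
qed

lemma card_cycle_edges: "card (cycle_edges r) = r"
  unfolding cycle_edges_def by (simp add: card_image[OF inj_on_cycle_edge])

lemma Union_cycle_edges: "\<Union> (cycle_edges r) = {..<r}"
  using r by (auto simp: cycle_edges_def)

lemma cycle_edges_nsets: "cycle_edges r \<subseteq> [{..<r}]\<^bsup>2\<^esup>"
  using r Suc_mod_neq by (fastforce simp: cycle_edges_def nsets_def card_2_iff)

text \<open>Each edge is charged to its first end point. If there were no further vertex, the set of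
  charged vertices would be closed under successor, hence everything, and \<open>K\<close> would be
  the whole cycle.\<close>

lemma card_Union_cycle_part:
  assumes "K \<subset> cycle_edges r" "K \<noteq> {}"
  shows "card K < card (\<Union> K)"
proof (rule ccontr)
  assume "\<not> card K < card (\<Union> K)"
  then have le: "card (\<Union> K) \<le> card K" by simp
  define J where "J = {i \<in> {..<r}. {i, Suc i mod r} \<in> K}"
  have K: "K = (\<lambda>i. {i, Suc i mod r}) ` J"
    using assms by (auto simp: J_def cycle_edges_def)
  have "card K = card J"
    unfolding K by (rule card_image) (auto intro: inj_on_subset[OF inj_on_cycle_edge] simp: J_def)
  moreover have "finite (\<Union> K)"
    using assms Union_cycle_edges finite_subset[of "\<Union> K" "{..<r}"] by blast
  moreover have "J \<subseteq> \<Union> K" unfolding K by auto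
  ultimately have "J = \<Union> K"
    using le by (intro card_seteq) auto
  then have "Suc i mod r \<in> J" if "i \<in> J" for i
    using that unfolding K by blast
  moreover have "J \<noteq> {}" using assms(2) K by blast
  moreover have "J \<subseteq> {..<r}" by (auto simp: J_def)
  ultimately have "J = {..<r}" using cycle_successor_closed by blast
  then show False using assms K by (simp add: cycle_edges_def)
qed

text \<open>A copy is stored by its edge set alone, which identifies the injections that differ by a
  symmetry of the cycle. The vertex set is recovered as the union, as a cycle has no isolated
  vertices.\<close>

definition cycles :: "nat \<Rightarrow> nat set set set" where
  "cycles n = (\<lambda>f. (`) f ` cycle_edges r) ` {f. inj_on f {..<r} \<and> f ` {..<r} \<subseteq> {..<n}}"

lemma cyclesE:
  assumes "a \<in> cycles n"
  obtains f where "inj_on f {..<r}" "f ` {..<r} \<subseteq> {..<n}" "a = (`) f ` cycle_edges r"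
    "\<Union> a = f ` {..<r}"
  using assms unfolding cycles_def by (auto simp: image_Union[symmetric] Union_cycle_edges)

lemma inj_on_image_cycle_edges:
  assumes "inj_on f {..<r}"
  shows "inj_on ((`) f) (cycle_edges r)"
  using inj_on_image_Pow[OF assms] Union_cycle_edges by (blast intro: inj_on_subset)

lemma cycles_Union:
  assumes "a \<in> cycles n"
  shows "\<Union> a \<subseteq> {..<n}" "card (\<Union> a) = r" "card a = r" "a \<subseteq> [\<Union> a]\<^bsup>2\<^esup>" "a \<subseteq> [{..<n}]\<^bsup>2\<^esup>"
proof -
  obtain f where f: "inj_on f {..<r}" "f ` {..<r} \<subseteq> {..<n}" "a = (`) f ` cycle_edges r"
    "\<Union> a = f ` {..<r}"
    using assms by (rule cyclesE)
  show U: "\<Union> a \<subseteq> {..<n}" using f by simp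
  show "card (\<Union> a) = r" using f by (simp add: card_image)
  show "card a = r"
    using f card_cycle_edges by (simp add: card_image inj_on_image_cycle_edges)
  show "a \<subseteq> [\<Union> a]\<^bsup>2\<^esup>"
  proof
    fix e assume "e \<in> a"
    then obtain e' where e': "e' \<in> cycle_edges r" "e = f ` e'" using f by auto
    then have "e' \<subseteq> {..<r}" "finite e'" "card e' = 2"
      using cycle_edges_nsets by (auto simp: nsets_def)
    then show "e \<in> [\<Union> a]\<^bsup>2\<^esup>"
      using f e' by (auto simp: nsets_def card_image inj_on_subset)
  qed
  then show "a \<subseteq> [{..<n}]\<^bsup>2\<^esup>"
    using nsets_mono[OF U] by blast
qed

lemma finite_cycles: "finite (cycles n)"
proof (rule finite_subset)
  show "cycles n \<subseteq> Pow ([{..<n}]\<^bsup>2\<^esup>)" using cycles_Union(5) by blast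
  show "finite (Pow ([{..<n}]\<^bsup>2\<^esup>))" by (simp add: finite_imp_finite_nsets)
qed

lemma card_Union_part:
  assumes "a \<in> cycles n" "K \<subset> a" "K \<noteq> {}"
  shows "card K < card (\<Union> K)"
proof -
  obtain f where f: "inj_on f {..<r}" "a = (`) f ` cycle_edges r"
    using assms(1) by (rule cyclesE)
  define K' where "K' = {e \<in> cycle_edges r. f ` e \<in> K}"
  have K: "K = (`) f ` K'" using assms f by (auto simp: K'_def)
  have "K' \<subseteq> cycle_edges r" by (auto simp: K'_def)
  moreover have "K' \<noteq> cycle_edges r" using K f(2) assms(2) by blast
  ultimately have sub: "K' \<subset> cycle_edges r" by blast
  have "card K = card K'"
    unfolding K using sub by (intro card_image inj_on_subset[OF inj_on_image_cycle_edges[OF f(1)]]) auto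
  also have "\<dots> < card (\<Union> K')"
    using sub assms K by (intro card_Union_cycle_part) auto
  also have "\<dots> = card (f ` (\<Union> K'))"
    using sub Union_cycle_edges by (intro card_image[symmetric] inj_on_subset[OF f(1)]) blast
  also have "f ` (\<Union> K') = \<Union> K" unfolding K by auto
  finally show ?thesis .
qed

text \<open>The vertex set is an \<open>r\<close>-set containing \<open>V\<close>, which leaves
  \<open>r - card V\<close> vertices to choose; on it a cycle is one of the
  \<open>2 ^ (r choose 2)\<close> sets of pairs.\<close>

lemma card_cycles_through_le:
  assumes "V \<subseteq> {..<n}"
  shows "card {a \<in> cycles n. V \<subseteq> \<Union> a} \<le> 2 ^ (r choose 2) * n ^ (r - card V)"
proof -
  let ?Ws = "{W. W \<subseteq> {..<n} \<and> card W = r \<and> V \<subseteq> W}"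
  have fin: "finite ?Ws" "finite V"
    using assms finite_subset by (auto intro: finite_subset[of _ "Pow {..<n}"])
  have "inj_on (\<lambda>W. W - V) ?Ws" by (auto simp: inj_on_def)
  moreover have "(\<lambda>W. W - V) ` ?Ws \<subseteq> {S. S \<subseteq> {..<n} \<and> card S = r - card V}"
    using fin by (auto simp: card_Diff_subset)
  moreover have "finite {S. S \<subseteq> {..<n} \<and> card S = r - card V}"
    by (auto intro: finite_subset[of _ "Pow {..<n}"])
  ultimately have "card ?Ws \<le> card {S. S \<subseteq> {..<n} \<and> card S = r - card V}"
    by (rule card_inj_on_le)
  also have "\<dots> = n choose (r - card V)"
    using n_subsets[of "{..<n}" "r - card V"] by simp
  also have "\<dots> \<le> n ^ (r - card V)"
    by (cases "r - card V \<le> n") (simp_all add: binomial_le_pow binomial_eq_0)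
  finally have Ws: "card ?Ws \<le> n ^ (r - card V)" .
  have "{a \<in> cycles n. V \<subseteq> \<Union> a} \<subseteq> (\<Union>W\<in>?Ws. Pow ([W]\<^bsup>2\<^esup>))"
  proof
    fix a assume "a \<in> {a \<in> cycles n. V \<subseteq> \<Union> a}"
    then show "a \<in> (\<Union>W\<in>?Ws. Pow ([W]\<^bsup>2\<^esup>))"
      using cycles_Union[of a n] by (intro UN_I[of "\<Union> a"]) auto
  qed
  moreover have "finite (Pow ([W]\<^bsup>2\<^esup>))" if "W \<in> ?Ws" for W
    using that finite_subset[of W "{..<n}"] by (simp add: finite_imp_finite_nsets)
  ultimately have "card {a \<in> cycles n. V \<subseteq> \<Union> a} \<le> card (\<Union>W\<in>?Ws. Pow ([W]\<^bsup>2\<^esup>))"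
    using fin by (intro card_mono finite_UN_I)
  also have "\<dots> \<le> (\<Sum>W\<in>?Ws. card (Pow ([W]\<^bsup>2\<^esup>)))"
    by (rule card_UN_le[OF fin(1)])
  also have "\<dots> = card ?Ws * 2 ^ (r choose 2)"
  proof -
    have "card (Pow ([W]\<^bsup>2\<^esup>)) = 2 ^ (r choose 2)" if "W \<in> ?Ws" for W
    proof -
      have "finite W" using that finite_subset by auto
      then show ?thesis
        using that by (simp add: card_Pow finite_imp_finite_nsets card_nsets)
    qed
    then show ?thesis by simp
  qed
  also have "\<dots> \<le> n ^ (r - card V) * 2 ^ (r choose 2)"
    using Ws by (rule mult_le_mono1)
  finally show ?thesis by (simp add: mult.commute)
qed

lemma card_cycles_le: "card (cycles n) \<le> 2 ^ (r choose 2) * n ^ r"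
  using card_cycles_through_le[of "{}" n] by simp

text \<open>Every \<open>r\<close>-subset of the vertices carries at least one cycle.\<close>

lemma card_cycles_ge:
  assumes "r \<le> n"
  shows "(real n / real r) ^ r \<le> real (card (cycles n))"
proof -
  have "{W. W \<subseteq> {..<n} \<and> card W = r} \<subseteq> \<Union> ` cycles n"
  proof
    fix W assume "W \<in> {W. W \<subseteq> {..<n} \<and> card W = r}"
    then have W: "W \<subseteq> {..<n}" "card W = r" "finite W" by (auto intro: finite_subset)
    then obtain f where f: "bij_betw f {..<r} W"
      using ex_bij_betw_nat_finite[of W] by (auto simp: atLeast0LessThan)
    then have "(`) f ` cycle_edges r \<in> cycles n"
      using W unfolding cycles_def bij_betw_def by auto
    moreover have "\<Union> ((`) f ` cycle_edges r) = W"
      using f by (simp add: image_Union[symmetric] Union_cycle_edges bij_betw_def)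
    ultimately show "W \<in> \<Union> ` cycles n" by (metis imageI)
  qed
  then have "card {W. W \<subseteq> {..<n} \<and> card W = r} \<le> card (cycles n)"
    using finite_cycles by (meson card_image_le card_mono finite_imageI le_trans)
  then have "n choose r \<le> card (cycles n)"
    using n_subsets[of "{..<n}" r] by simp
  moreover have "(real n / real r) ^ r \<le> real (n choose r)"
    using binomial_ge_n_over_k_pow_k[of r n] assms by simp
  ultimately show ?thesis by linarith
qed

text \<open>Sending an edge set to its graph is a bijection from the cycles inside
  \<open>\<omega>\<close> to the isomorphic subgraphs, since isolated vertices cannot occur in a
  copy.\<close>

lemma subgraph_count_cycle:
  assumes "\<omega> \<subseteq> [{..<n}]\<^bsup>2\<^esup>"
  shows "subgraph_count (cycle_graph r) ({..<n}, \<omega>) = card {a \<in> cycles n. a \<subseteq> \<omega>}"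
proof -
  have "{S \<in> subgraphs ({..<n}, \<omega>). graph_isomorphic (cycle_graph r) S} =
      (\<lambda>a. (\<Union> a, a)) ` {a \<in> cycles n. a \<subseteq> \<omega>}" (is "?L = ?R")
  proof (intro equalityI subsetI)
    fix S assume S: "S \<in> ?L"
    obtain V a where Va: "S = (V, a)" by (cases S)
    obtain f where f: "bij_betw f {..<r} V" "a = (`) f ` cycle_edges r"
      using S Va by (auto simp: graph_isomorphic_def cycle_graph_eq)
    have "V \<subseteq> {..<n}" "a \<subseteq> \<omega>" using S Va by (auto simp: subgraphs_def)
    moreover have "\<Union> a = V"
      using f by (simp add: image_Union[symmetric] Union_cycle_edges bij_betw_def)
    moreover have "a \<in> cycles n"
      using f \<open>V \<subseteq> {..<n}\<close> unfolding cycles_def bij_betw_def by auto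
    ultimately show "S \<in> ?R" using Va by blast
  next
    fix S assume "S \<in> ?R"
    then obtain a where a: "S = (\<Union> a, a)" "a \<in> cycles n" "a \<subseteq> \<omega>" by auto
    obtain f where f: "inj_on f {..<r}" "a = (`) f ` cycle_edges r" "\<Union> a = f ` {..<r}"
      using a(2) by (rule cyclesE)
    have "graph_isomorphic (cycle_graph r) S"
      unfolding graph_isomorphic_def cycle_graph_eq a(1) using f
      by (auto intro!: exI[of _ f] simp: bij_betw_def)
    then show "S \<in> ?L"
      using a cycles_Union[OF a(2)] by (simp add: subgraphs_def)
  qed
  moreover have "inj_on (\<lambda>a. (\<Union> a, a)) {a \<in> cycles n. a \<subseteq> \<omega>}"
    by (auto simp: inj_on_def)
  ultimately show ?thesis
    by (simp add: subgraph_count_def card_image)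
qed

end

section \<open>Gluing cycles and the variance\<close>

text \<open>The cycles are grouped by their nonempty trace \<open>K\<close> on \<open>U\<close>, for
  which there are at most \<open>2 ^ (3 * r)\<close> choices. A full trace determines the cycle. A
  proper trace with k edges fixes at least k + 1 vertices, so its group has weight at most a
  constant times P / (n (n p)^k).\<close>

lemma glue_cycles:
  fixes p :: real
  assumes r: "r \<ge> 3" and p: "0 < p" "p < 1" and np: "1 \<le> real n * p"
    and U: "U \<subseteq> [{..<n}]\<^bsup>2\<^esup>" "card U \<le> 3 * r"
  defines "P \<equiv> (real n * p) ^ r" and "m \<equiv> min (real n ^ 2 * p) ((real n * p) ^ r)"
  shows "(\<Sum>a\<in>cycles r n. of_bool (a \<inter> U \<noteq> {}) * p ^ card (a - U)) \<le>
    2 ^ (3 * r) * 2 ^ (r choose 2) * (P / m)"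
proof -
  have n: "0 < real n" using np p by (cases n) auto
  have m: "0 < m" "m \<le> P" "m \<le> real n * (real n * p)"
    using n p by (auto simp: m_def P_def power2_eq_square mult_ac)
  have finU: "finite U"
    using U(1) by (rule finite_subset) (simp add: finite_imp_finite_nsets)
  let ?S = "{a \<in> cycles r n. a \<inter> U \<noteq> {}}" and ?T = "Pow U - {{}}"
  have part: "(\<Sum>a\<in>{a \<in> ?S. a \<inter> U = K}. p ^ card (a - U)) \<le> 2 ^ (r choose 2) * (P / m)"
    if K: "K \<in> ?T" for K
  proof -
    let ?SK = "{a \<in> ?S. a \<inter> U = K}"
    have fin: "finite ?SK" using finite_cycles[OF r] by simp
    have "card (a - U) = r - card K" if "a \<in> ?SK" for a
    proof -
      have "a - U = a - K" "K \<subseteq> a" using that by auto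
      moreover have "finite K" using K finU finite_subset by blast
      ultimately show ?thesis
        using cycles_Union(3)[OF r, of a n] that by (simp add: card_Diff_subset)
    qed
    then have "(\<Sum>a\<in>?SK. p ^ card (a - U)) = (\<Sum>a\<in>?SK. p ^ (r - card K))"
      by (intro sum.cong refl) (simp only:)
    then have sum_eq: "(\<Sum>a\<in>?SK. p ^ card (a - U)) = real (card ?SK) * p ^ (r - card K)"
      by simp
    show ?thesis
    proof (cases "?SK = {}")
      case True
      then have "real (card ?SK) = 0" by (simp only: card.empty of_nat_0)
      then show ?thesis unfolding sum_eq using m n p by (simp add: P_def)
    next
      case False
      then obtain a where a: "a \<in> cycles r n" "a \<inter> U = K" by blast
      have card_a: "card a = r" "finite a"
        using cycles_Union(3)[OF r a(1)] r by (auto intro: card_ge_0_finite)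
      consider "K = a" | "K \<subset> a" using a by blast
      then show ?thesis
      proof cases
        case 1
        \<comment> \<open>A cycle with the same trace contains \<open>a\<close> and has equally many
          edges, so it is \<open>a\<close>.\<close>
        have "?SK \<subseteq> {a}"
        proof
          fix x assume "x \<in> ?SK"
          then have "a \<subseteq> x" "x \<in> cycles r n" using 1 by auto
          then show "x \<in> {a}"
            using card_a cycles_Union(3)[OF r, of x n] r
            by (metis card_ge_0_finite card_subset_eq gr0I not_numeral_le_zero singletonI)
        qed
        then have "card ?SK \<le> 1"
          using card_mono[of "{a}" ?SK] by simp
        then have "real (card ?SK) * p ^ (r - card K) \<le> 1 * 1"
          using 1 card_a by simp
        also have "\<dots> \<le> 2 ^ (r choose 2) * (P / m)"
          using m by (intro mult_mono) (auto simp: P_def n p)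
        finally show ?thesis unfolding sum_eq .
      next
        case 2
        have less: "card K < card (\<Union> K)"
          using card_Union_part[OF r a(1) 2] K by blast
        have "card K < r" using psubset_card_mono[OF card_a(2) 2] card_a by simp
        \<comment> \<open>\<open>j\<close> bounds the number of vertices still free:
          \<open>card K\<close> edges use up at least one vertex more than their number.\<close>
        then obtain j where j: "r = j + 1 + card K"
          by (metis add.commute add.left_commute less_imp_add_positive Suc_pred' add_Suc_right plus_1_eq_Suc)
        have "card K \<noteq> 0" using K finU finite_subset[of K U] by auto
        have sub: "\<Union> K \<subseteq> {..<n}"
          using 2 cycles_Union(1)[OF r a(1)] by blast
        have "card ?SK \<le> card {x \<in> cycles r n. \<Union> K \<subseteq> \<Union> x}"
          using finite_cycles[OF r, of n] by (intro card_mono) auto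
        also have "\<dots> \<le> 2 ^ (r choose 2) * n ^ (r - card (\<Union> K))"
          by (rule card_cycles_through_le[OF r sub])
        also have "\<dots> \<le> 2 ^ (r choose 2) * n ^ j"
          using less j n by (intro mult_le_mono2 power_increasing) auto
        finally have "real (card ?SK) \<le> real (2 ^ (r choose 2) * n ^ j)"
          by (rule of_nat_mono)
        then have card_SK: "real (card ?SK) \<le> 2 ^ (r choose 2) * real n ^ j" by simp
        \<comment> \<open>Here \<open>1 \<le> real n * p\<close> enters: raising
          \<open>real n * p\<close> to a higher positive power keeps it above the first power, whose
          product with \<open>n\<close> is \<open>real n ^ 2 * p\<close>.\<close>
        have "m \<le> real n * (real n * p) ^ card K"
        proof -
          have "(real n * p) ^ 1 \<le> (real n * p) ^ card K"
            using np \<open>card K \<noteq> 0\<close> by (intro power_increasing) auto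
          then show ?thesis using m(3) n by (simp add: order_trans[OF m(3)])
        qed
        then have "real n ^ j * p ^ (j + 1) * m \<le> real n ^ j * p ^ (j + 1) * (real n * (real n * p) ^ card K)"
          using n p by (intro mult_left_mono) auto
        also have "\<dots> = P"
          unfolding P_def j by (simp add: power_add power_mult_distrib mult_ac)
        finally have "real n ^ j * p ^ (j + 1) \<le> P / m"
          using m by (simp add: field_simps)
        then have "2 ^ (r choose 2) * (real n ^ j * p ^ (j + 1)) \<le> 2 ^ (r choose 2) * (P / m)"
          by (intro mult_left_mono) auto
        moreover have "real (card ?SK) * p ^ (r - card K) \<le> 2 ^ (r choose 2) * real n ^ j * p ^ (j + 1)"
          using card_SK j p by (intro mult_mono) auto
        ultimately show ?thesis unfolding sum_eq mult.assoc by (rule order_trans[rotated])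
      qed
    qed
  qed
  have "(\<Sum>a\<in>cycles r n. of_bool (a \<inter> U \<noteq> {}) * p ^ card (a - U)) = (\<Sum>a\<in>?S. p ^ card (a - U))"
    using finite_cycles[OF r] by (intro sum.mono_neutral_cong_right) auto
  also have "\<dots> = (\<Sum>K\<in>?T. \<Sum>a\<in>{a \<in> ?S. a \<inter> U = K}. p ^ card (a - U))"
    using finite_cycles[OF r] finU by (intro sum.group[symmetric]) auto
  also have "\<dots> \<le> (\<Sum>K\<in>?T. 2 ^ (r choose 2) * (P / m))"
    by (intro sum_mono part)
  also have "\<dots> = real (card ?T) * (2 ^ (r choose 2) * (P / m))" by simp
  also have "\<dots> \<le> 2 ^ (3 * r) * (2 ^ (r choose 2) * (P / m))"
  proof (intro mult_right_mono)
    have "card ?T \<le> card (Pow U)" using finU by (intro card_mono) auto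
    also have "\<dots> \<le> 2 ^ (3 * r)" using finU U(2) by (simp add: card_Pow)
    finally have "real (card ?T) \<le> real (2 ^ (3 * r))" by (rule of_nat_mono)
    then show "real (card ?T) \<le> 2 ^ (3 * r)" by simp
  qed (use m in \<open>auto simp: P_def n p\<close>)
  finally show ?thesis by (simp add: mult.assoc)
qed

section \<open>Lower bounds for the variance\<close>

context edge_family
begin

lemma var_N_eq: "var_N = (\<Sum>a\<in>Fam. \<Sum>b\<in>Fam. p ^ card (a \<union> b) - p ^ (2 * r))"
proof -
  have "expect (\<lambda>\<omega>. (N \<omega>)\<^sup>2) = expect (\<lambda>\<omega>. \<Sum>a\<in>Fam. \<Sum>b\<in>Fam. of_bool (a \<union> b \<subseteq> \<omega>))"
    by (intro subset_expectation_cong)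
      (auto simp: N_def power2_eq_square sum_product simp flip: of_bool_conj)
  also have "\<dots> = (\<Sum>a\<in>Fam. \<Sum>b\<in>Fam. p ^ card (a \<union> b))"
    unfolding subset_expectation_sum using Fam_sub
    by (intro sum.cong refl subset_expectation_subset finite_E) blast
  finally have N2: "expect (\<lambda>\<omega>. (N \<omega>)\<^sup>2) = (\<Sum>a\<in>Fam. \<Sum>b\<in>Fam. p ^ card (a \<union> b))" .
  have "var_N = expect (\<lambda>\<omega>. (N \<omega>)\<^sup>2 - 2 * \<mu> * N \<omega> + \<mu>\<^sup>2)"
    unfolding var_N_def by (intro subset_expectation_cong) (simp add: power2_diff mult_ac)
  also have "\<dots> = expect (\<lambda>\<omega>. (N \<omega>)\<^sup>2) - \<mu>\<^sup>2"
    by (simp add: subset_expectation_add subset_expectation_diff subset_expectation_cmult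
        subset_expectation_const[OF finite_E] expect_N power2_eq_square)
  also have "\<mu>\<^sup>2 = (\<Sum>a\<in>Fam. \<Sum>b\<in>Fam. p ^ (2 * r))"
    by (simp add: \<mu>_def power2_eq_square power_mult mult_ac)
  finally show ?thesis unfolding N2 by (simp add: sum_subtractf)
qed

lemma covariance_ge:
  assumes ab: "a \<in> Fam" "b \<in> Fam"
  shows "0 \<le> p ^ card (a \<union> b) - p ^ (2 * r)"
    and "a \<inter> b \<noteq> {} \<Longrightarrow> p ^ (2 * r - 1) * (1 - p) \<le> p ^ card (a \<union> b) - p ^ (2 * r)"
proof -
  have cards: "card (a \<union> b) + card (a \<inter> b) = 2 * r"
    using card_Un_Int[of a b] ab finite_member Fam_card by simp
  then show "0 \<le> p ^ card (a \<union> b) - p ^ (2 * r)"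
    using p01 by (auto intro!: power_decreasing)
  assume "a \<inter> b \<noteq> {}"
  then have "card (a \<inter> b) \<ge> 1"
    using ab finite_member by (simp add: Suc_le_eq card_gt_0_iff)
  then have le: "card (a \<union> b) \<le> 2 * r - 1" and pos: "2 * r = Suc (2 * r - 1)"
    using cards by auto
  have "p ^ (2 * r - 1) \<le> p ^ card (a \<union> b)"
    using le p01 by (intro power_decreasing) auto
  moreover have "p ^ (2 * r) = p * p ^ (2 * r - 1)"
    by (subst pos) simp
  ultimately show "p ^ (2 * r - 1) * (1 - p) \<le> p ^ card (a \<union> b) - p ^ (2 * r)"
    by (simp add: algebra_simps)
qed

lemma var_N_nonneg: "0 \<le> var_N"
  unfolding var_N_eq by (intro sum_nonneg covariance_ge(1))

text \<open>All covariances are nonnegative, so the pairs with \<open>a = b\<close> alone give a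
  lower bound; it has the right order when distinct copies overlap little.\<close>

lemma var_N_ge_diagonal:
  assumes "1 \<le> r"
  shows "real (card Fam) * (p ^ r * (1 - p)) \<le> var_N"
proof -
  have "real (card Fam) * (p ^ r * (1 - p)) = (\<Sum>a\<in>Fam. p ^ r * (1 - p))" by simp
  also have "\<dots> \<le> (\<Sum>a\<in>Fam. \<Sum>b\<in>Fam. p ^ card (a \<union> b) - p ^ (2 * r))"
  proof (rule sum_mono)
    fix a assume a: "a \<in> Fam"
    have "p ^ r \<le> p ^ 1" using assms p01 by (intro power_decreasing) auto
    then have "p ^ r * (1 - p) \<le> p ^ r * (1 - p ^ r)"
      using p01 by (intro mult_left_mono) auto
    also have "\<dots> = p ^ card (a \<union> a) - p ^ (2 * r)"
      using a by (simp add: Fam_card right_diff_distrib mult_2 flip: power_add)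
    also have "\<dots> \<le> (\<Sum>b\<in>Fam. p ^ card (a \<union> b) - p ^ (2 * r))"
      using a finite_Fam covariance_ge(1)[OF a]
      by (intro member_le_sum[of a Fam "\<lambda>b. p ^ card (a \<union> b) - p ^ (2 * r)"]) auto
    finally show "p ^ r * (1 - p) \<le> (\<Sum>b\<in>Fam. p ^ card (a \<union> b) - p ^ (2 * r))" .
  qed
  finally show ?thesis by (simp add: var_N_eq)
qed

text \<open>Let \<open>d e\<close> be the number of members through \<open>e\<close>. The sum of
  squares of \<open>d\<close> counts pairs by their common elements, at most \<open>r\<close> each,
  and is bounded below by Cauchy-Schwarz from the sum of \<open>d\<close>, which is \<open>r\<close>
  times the number of members.\<close>

lemma var_N_ge_pairs:
  assumes "1 \<le> r"
  shows "real (card Fam) ^ 2 * (p ^ (2 * r - 1) * (1 - p)) \<le> real (card E) * var_N"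
proof -
  let ?q = "p ^ (2 * r - 1) * (1 - p)"
  have q: "0 \<le> ?q" using p01 by simp
  define d where "d e = (\<Sum>a\<in>Fam. of_bool (e \<in> a) :: real)" for e
  have card_eq: "(\<Sum>e\<in>E. of_bool (e \<in> a)) = real (card a)" if "a \<subseteq> E" for a
  proof -
    have "E \<inter> a = a" using that by blast
    then show ?thesis using finite_E by (simp add: Int_def)
  qed
  have "(\<Sum>e\<in>E. d e) = (\<Sum>a\<in>Fam. \<Sum>e\<in>E. of_bool (e \<in> a))"
    unfolding d_def by (rule sum.swap)
  also have "\<dots> = real (card Fam) * real r"
    using Fam_sub Fam_card by (simp add: card_eq)
  finally have d1: "(\<Sum>e\<in>E. d e) = real (card Fam) * real r" .
  have "(\<Sum>e\<in>E. (d e)\<^sup>2) = (\<Sum>e\<in>E. \<Sum>a\<in>Fam. \<Sum>b\<in>Fam. of_bool (e \<in> a \<inter> b))"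
    unfolding d_def power2_eq_square sum_product by (intro sum.cong refl) auto
  also have "\<dots> = (\<Sum>a\<in>Fam. \<Sum>e\<in>E. \<Sum>b\<in>Fam. of_bool (e \<in> a \<inter> b))"
    by (rule sum.swap)
  also have "\<dots> = (\<Sum>a\<in>Fam. \<Sum>b\<in>Fam. \<Sum>e\<in>E. of_bool (e \<in> a \<inter> b))"
    by (rule sum.cong[OF refl], rule sum.swap)
  also have "\<dots> = (\<Sum>a\<in>Fam. \<Sum>b\<in>Fam. real (card (a \<inter> b)))"
  proof (rule sum.cong[OF refl], rule sum.cong[OF refl])
    fix a b assume "a \<in> Fam" "b \<in> Fam"
    then show "(\<Sum>e\<in>E. of_bool (e \<in> a \<inter> b)) = real (card (a \<inter> b))"
      using Fam_sub by (intro card_eq) blast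
  qed
  finally have d2: "(\<Sum>e\<in>E. (d e)\<^sup>2) = (\<Sum>a\<in>Fam. \<Sum>b\<in>Fam. real (card (a \<inter> b)))" .
  have "(\<Sum>e\<in>E. (d e)\<^sup>2) * ?q \<le> real r * var_N"
    unfolding d2 var_N_eq sum_distrib_left sum_distrib_right
  proof (intro sum_mono)
    fix a b assume ab: "a \<in> Fam" "b \<in> Fam"
    show "real (card (a \<inter> b)) * ?q \<le> real r * (p ^ card (a \<union> b) - p ^ (2 * r))"
    proof (cases "a \<inter> b = {}")
      case True
      then show ?thesis using covariance_ge(1)[OF ab] by simp
    next
      case False
      have "card (a \<inter> b) \<le> r"
        using ab Fam_card finite_member by (metis card_mono inf_le1)
      then show ?thesis
        using covariance_ge(2)[OF ab False] q by (intro mult_mono) auto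
    qed
  qed
  then have "real (card E) * ((\<Sum>e\<in>E. (d e)\<^sup>2) * ?q) \<le> real (card E) * (real r * var_N)"
    by (rule mult_left_mono) simp
  moreover have "(real (card Fam) * real r)\<^sup>2 \<le> (\<Sum>e\<in>E. (d e)\<^sup>2) * real (card E)"
    using sum_squared_le_sum_of_squares[of d E] by (simp add: d1)
  then have "(real (card Fam) * real r)\<^sup>2 * ?q \<le> (\<Sum>e\<in>E. (d e)\<^sup>2) * real (card E) * ?q"
    using q by (rule mult_right_mono)
  ultimately have "(real (card Fam) * real r)\<^sup>2 * ?q \<le> real (card E) * (real r * var_N)"
    by (simp only: mult_ac)
  moreover have "real r * real (card Fam) ^ 2 * ?q \<le> (real (card Fam) * real r)\<^sup>2 * ?q"
  proof (intro mult_right_mono)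
    have "real r * (real (card Fam))\<^sup>2 * 1 \<le> real r * (real (card Fam))\<^sup>2 * real r"
      using assms by (intro mult_left_mono) auto
    then show "real r * (real (card Fam))\<^sup>2 \<le> (real (card Fam) * real r)\<^sup>2"
      by (simp add: power2_eq_square mult_ac)
  qed (rule q)
  ultimately have "real r * (real (card Fam) ^ 2 * ?q) \<le> real r * (real (card E) * var_N)"
    by (simp add: mult_ac)
  then show ?thesis using assms by simp
qed

end

section \<open>The Kolmogorov bound\<close>

text \<open>Almost surely \<open>\<omega>\<close> takes the default value \<open>False\<close>
  outside \<open>E\<close>, so the law lives on the indicator functions of subsets of
  \<open>E\<close>, with the product weights of \<open>subset_expectation\<close>.\<close>

lemma expectation_Pi_bernoulli:
  fixes g :: "'e set \<Rightarrow> real"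
  assumes E: "finite E" and p: "0 < p" "p < 1"
  shows "measure_pmf.expectation (Pi_pmf E False (\<lambda>_. bernoulli_pmf p)) (\<lambda>\<omega>. g {e \<in> E. \<omega> e}) =
    subset_expectation E p g"
proof -
  let ?M = "Pi_pmf E False (\<lambda>_. bernoulli_pmf p)"
  have inj: "inj_on (\<lambda>S e. e \<in> S) (Pow E)"
    by (auto simp: inj_on_def fun_eq_iff)
  have "set_pmf ?M \<subseteq> (\<lambda>S e. e \<in> S) ` Pow E"
  proof
    fix \<omega> assume "\<omega> \<in> set_pmf ?M"
    then have "\<omega> e = False" if "e \<notin> E" for e
      using set_Pi_pmf_subset[OF E, of False "\<lambda>_. bernoulli_pmf p"] that by blast
    then show "\<omega> \<in> (\<lambda>S e. e \<in> S) ` Pow E"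
      by (intro image_eqI[of _ _ "{e. \<omega> e}"]) auto
  qed
  then have "measure_pmf.expectation ?M (\<lambda>\<omega>. g {e \<in> E. \<omega> e}) =
      (\<Sum>\<omega>\<in>(\<lambda>S e. e \<in> S) ` Pow E. pmf ?M \<omega> *\<^sub>R g {e \<in> E. \<omega> e})"
    using E by (intro integral_measure_pmf) auto
  also have "\<dots> = (\<Sum>S\<in>Pow E. pmf ?M (\<lambda>e. e \<in> S) * g {e \<in> E. e \<in> S})"
    by (simp add: sum.reindex[OF inj])
  also have "\<dots> = subset_expectation E p g"
    unfolding subset_expectation_def
  proof (intro sum.cong refl arg_cong2[where f = "(*)"] arg_cong[where f = g])
    fix S assume S: "S \<in> Pow E"
    have "pmf ?M (\<lambda>e. e \<in> S) = (\<Prod>e\<in>E. pmf (bernoulli_pmf p) (e \<in> S))"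
      using S by (intro pmf_Pi'[OF E]) auto
    also have "\<dots> = (\<Prod>e\<in>E. if e \<in> S then p else 1 - p)"
      using p by (intro prod.cong) auto
    also have "\<dots> = p ^ card (E \<inter> S) * (1 - p) ^ card (E \<inter> - S)"
      using E by (simp add: prod.If_cases)
    also have "E \<inter> S = S" using S by blast
    also have "E \<inter> - S = E - S" by blast
    finally show "pmf ?M (\<lambda>e. e \<in> S) = p ^ card S * (1 - p) ^ card (E - S)" .
    show "{e \<in> E. e \<in> S} = S" using S by blast
  qed
  finally show ?thesis .
qed

lemma expectation_random_graph:
  assumes p: "0 < p" "p < 1"
  shows "measure_pmf.expectation (random_graph n p) g =
    subset_expectation ([{..<n}]\<^bsup>2\<^esup>) p (\<lambda>\<omega>. g ({..<n}, \<omega>))"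
  using expectation_Pi_bernoulli[of "[{..<n}]\<^bsup>2\<^esup>" p "\<lambda>\<omega>. g ({..<n}, \<omega>)"] p
  by (simp add: random_graph_def finite_imp_finite_nsets)

lemma cdf_distr_pmf:
  "cdf (distr (measure_pmf M) borel X) z = measure_pmf.expectation M (\<lambda>\<omega>. of_bool (X \<omega> \<le> z))"
proof -
  have "cdf (distr (measure_pmf M) borel X) z = measure (measure_pmf M) {\<omega>. X \<omega> \<le> z}"
    unfolding cdf_def by (simp add: measure_distr vimage_def)
  also have "\<dots> = measure_pmf.expectation M (indicator {\<omega>. X \<omega> \<le> z})"
    by simp
  also have "indicator {\<omega>. X \<omega> \<le> z} = (\<lambda>\<omega>. of_bool (X \<omega> \<le> z) :: real)"
    by (auto simp: indicator_def fun_eq_iff)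
  finally show ?thesis .
qed

lemma kolmogorov_distance_leI:
  assumes "\<And>z. \<bar>cdf M z - cdf N z\<bar> \<le> B"
  shows "kolmogorov_distance M N \<le> B"
  unfolding kolmogorov_distance_def using assms by (intro cSUP_least) auto

text \<open>Two distribution functions differ by at most 1. This settles the cases with
  \<open>real n * p < 1\<close>, where the claimed bounds exceed 1.\<close>

lemma kolmogorov_distance_law_le_1:
  "kolmogorov_distance (normalized_count_law G n p) std_normal_distribution \<le> 1"
proof (rule kolmogorov_distance_leI)
  fix z
  have "real_distribution (normalized_count_law G n p)"
    unfolding normalized_count_law_def by (rule prob_space.real_distribution_distr[OF prob_space_measure_pmf]) simp
  then interpret law: real_distribution "normalized_count_law G n p" .
  show "\<bar>cdf (normalized_count_law G n p) z - cdf std_normal_distribution z\<bar> \<le> 1"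
    using law.cdf_nonneg[of z] law.cdf_bounded_prob[of z] Phi_nonneg[of z] Phi_le_1[of z]
    by (simp add: Phi_def abs_le_iff)
qed

lemma cycle_edge_family:
  fixes p :: real
  assumes r: "r \<ge> 3" and p: "0 < p" "p < 1" and np: "1 \<le> real n * p"
  shows "edge_family ([{..<n}]\<^bsup>2\<^esup>) (cycles r n) p r (2 ^ (3 * r) * 2 ^ (r choose 2) *
    ((real n * p) ^ r / min (real n ^ 2 * p) ((real n * p) ^ r)))"
proof
  show "finite ([{..<n}]\<^bsup>2\<^esup>)" by (simp add: finite_imp_finite_nsets)
  show "a \<subseteq> [{..<n}]\<^bsup>2\<^esup>" "card a = r" if "a \<in> cycles r n" for a
    using cycles_Union[OF r that] by auto
qed (use glue_cycles[OF r p np] p in auto)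

text \<open>Up to constants the mean is at most P, the gluing bound is P / m, and the variance is at
  least (1 - p) P^2 / m. In the bound sqrt((1 - p) \<mu> L^3) / Var all powers of P cancel.\<close>

lemma kolmogorov_distance_cycle_count:
  assumes r: "r \<ge> 3"
  obtains C where "C > 0" and "\<And>n p. r \<le> n \<Longrightarrow> 0 < p \<Longrightarrow> p < 1 \<Longrightarrow> 1 \<le> real n * p \<Longrightarrow>
    kolmogorov_distance (normalized_count_law (cycle_graph r) n p) std_normal_distribution \<le>
    C / sqrt ((1 - p) * min (real n ^ 2 * p) ((real n * p) ^ r))"
proof -
  define K :: real where "K = 2 ^ (r choose 2)"
  define \<Lambda> :: real where "\<Lambda> = 2 ^ (3 * r) * K"
  \<comment> \<open>\<open>1 / real r ^ r\<close> comes from the lower bound on the number of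
    cycles. It is squared because the estimate by pairs contains the square of that number.\<close>
  define k :: real where "k = (1 / real r ^ r) ^ 2"
  define C where "C = 6 * sqrt (real r ^ 3 * K * \<Lambda> ^ 3) / k"
  have pos: "0 < K" "0 < \<Lambda>" "0 < k" using r by (auto simp: K_def \<Lambda>_def k_def)
  have "C > 0" using pos r by (simp add: C_def)
  moreover have "kolmogorov_distance (normalized_count_law (cycle_graph r) n p) std_normal_distribution \<le>
    C / sqrt ((1 - p) * min (real n ^ 2 * p) ((real n * p) ^ r))"
    if n: "r \<le> n" and p: "0 < p" "p < 1" and np: "1 \<le> real n * p" for n p
  proof (rule kolmogorov_distance_leI)
    fix z
    define P where "P = (real n * p) ^ r"
    define m where "m = min (real n ^ 2 * p) P"
    define L where "L = \<Lambda> * (P / m)"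
    have n0: "0 < real n" using n r by simp
    have P: "0 < P" and m: "0 < m" using n0 p by (auto simp: P_def m_def)
    interpret edge_family "[{..<n}]\<^bsup>2\<^esup>" "cycles r n" p r L
      unfolding L_def \<Lambda>_def K_def P_def m_def by (rule cycle_edge_family[OF r p np])
    let ?M = "random_graph n p" and ?X = "\<lambda>H. real (subgraph_count (cycle_graph r) H)"
    have N_eq: "N \<omega> = ?X ({..<n}, \<omega>)" if "\<omega> \<subseteq> [{..<n}]\<^bsup>2\<^esup>" for \<omega>
    proof -
      have "N \<omega> = real (card (cycles r n \<inter> {a. a \<subseteq> \<omega>}))"
        using finite_Fam by (simp add: N_def)
      then show ?thesis
        using subgraph_count_cycle[OF r that] by (simp add: Int_def)
    qed
    have mean: "measure_pmf.expectation ?M ?X = \<mu>"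
      unfolding expectation_random_graph[OF p] expect_N[symmetric]
      by (intro subset_expectation_cong) (simp add: N_eq)
    have var: "measure_pmf.variance ?M ?X = var_N"
      unfolding expectation_random_graph[OF p] mean[unfolded expectation_random_graph[OF p]] var_N_def
      by (intro subset_expectation_cong) (simp add: N_eq)
    have "cdf (normalized_count_law (cycle_graph r) n p) z =
        measure_pmf.expectation ?M (\<lambda>H. of_bool (standardized ?M ?X H \<le> z))"
      unfolding normalized_count_law_def by (rule cdf_distr_pmf)
    also have "\<dots> = expect (\<lambda>\<omega>. of_bool (standardized ?M ?X ({..<n}, \<omega>) \<le> z))"
      by (rule expectation_random_graph[OF p])
    also have "\<dots> = expect (\<lambda>\<omega>. of_bool ((N \<omega> - \<mu>) / sqrt var_N \<le> z))"
      by (intro subset_expectation_cong) (simp add: standardized_def mean var[unfolded mean] N_eq)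
    finally have cdf_eq: "cdf (normalized_count_law (cycle_graph r) n p) z = \<dots>" .
    have r1: "1 \<le> r" using r by simp
    have card_le: "real (card (cycles r n)) \<le> K * real n ^ r"
      using of_nat_mono[OF card_cycles_le[OF r, of n], where 'a = real] by (simp add: K_def)
    have card_ge: "real n ^ r / real r ^ r \<le> real (card (cycles r n))"
      using card_cycles_ge[OF r n] by (simp add: power_divide)
    have \<mu>_le: "\<mu> \<le> K * P"
      using mult_right_mono[OF card_le, of "p ^ r"] p by (simp add: \<mu>_def P_def power_mult_distrib mult_ac)
    have var_ge: "k * ((1 - p) * P\<^sup>2 / m) \<le> var_N"
    \<comment> \<open>The minimum decides which part of the variance is used: the diagonal if it is
      \<open>P\<close>, the pairs sharing an edge if it is \<open>real n ^ 2 * p\<close>.\<close>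
    proof (cases "P \<le> real n ^ 2 * p")
      case True
      then have "m = P" by (simp add: m_def)
      have "1 / real r ^ r \<le> 1" using r by (simp add: divide_le_eq)
      then have "k \<le> 1 / real r ^ r"
        unfolding k_def power2_eq_square using r by (intro mult_left_le) auto
      then have "k * ((1 - p) * P\<^sup>2 / m) \<le> 1 / real r ^ r * ((1 - p) * P\<^sup>2 / m)"
        using p P m by (intro mult_right_mono) auto
      also have "\<dots> = real n ^ r / real r ^ r * (p ^ r * (1 - p))"
        unfolding \<open>m = P\<close> using P by (simp add: P_def power2_eq_square power_mult_distrib mult_ac)
      also have "\<dots> \<le> real (card (cycles r n)) * (p ^ r * (1 - p))"
        using card_ge p by (intro mult_right_mono) auto
      also have "\<dots> \<le> var_N" by (rule var_N_ge_diagonal[OF r1])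
      finally show ?thesis .
    next
      case False
      then have "m = real n ^ 2 * p" by (simp add: m_def)
      have card_E: "real (card ([{..<n}]\<^bsup>2\<^esup>)) \<le> real n ^ 2"
      proof -
        have "card ([{..<n}]\<^bsup>2\<^esup>) = n choose 2" by (simp add: card_nsets)
        also have "\<dots> \<le> n ^ 2" using n r by (intro binomial_le_pow) simp
        finally have "real (card ([{..<n}]\<^bsup>2\<^esup>)) \<le> real (n ^ 2)" by (rule of_nat_mono)
        then show ?thesis by simp
      qed
      have "(real n ^ r / real r ^ r)\<^sup>2 * (p ^ (2 * r - 1) * (1 - p)) \<le>
          real (card (cycles r n)) ^ 2 * (p ^ (2 * r - 1) * (1 - p))"
        using card_ge p by (intro mult_right_mono power_mono) auto
      also have "\<dots> \<le> real (card ([{..<n}]\<^bsup>2\<^esup>)) * var_N"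
        by (rule var_N_ge_pairs[OF r1])
      also have "\<dots> \<le> real n ^ 2 * var_N"
        using card_E var_N_nonneg by (rule mult_right_mono)
      finally have le: "(real n ^ r / real r ^ r)\<^sup>2 * (p ^ (2 * r - 1) * (1 - p)) \<le> real n ^ 2 * var_N" .
      have "p ^ (2 * r) = p * p ^ (2 * r - 1)"
        using r by (simp flip: power_Suc)
      moreover have "P\<^sup>2 = (real n ^ r)\<^sup>2 * p ^ (2 * r)"
        by (simp add: P_def power_mult_distrib power_mult[symmetric] mult.commute[of r 2])
      ultimately have "k * ((1 - p) * P\<^sup>2 / m) * real n ^ 2 =
          (real n ^ r / real r ^ r)\<^sup>2 * (p ^ (2 * r - 1) * (1 - p))"
        unfolding \<open>m = real n ^ 2 * p\<close> k_def using n0 p by (simp add: power_divide)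
      then have "k * ((1 - p) * P\<^sup>2 / m) * real n ^ 2 \<le> var_N * real n ^ 2"
        using le by (simp only: mult.commute)
      then show ?thesis by (rule mult_right_le_imp_le) (use n0 in simp)
    qed
    have base: "0 < (1 - p) * P\<^sup>2 / m" using p P m by simp
    then have kbase: "0 < k * ((1 - p) * P\<^sup>2 / m)" using pos by (intro mult_pos_pos)
    then have var_pos: "0 < var_N" using var_ge by linarith
    have radicand: "0 \<le> real r ^ 3 * (1 - p) * (K * P) * L ^ 3"
      using p pos P L_nonneg by simp
    have "\<bar>cdf (normalized_count_law (cycle_graph r) n p) z - cdf std_normal_distribution z\<bar> \<le>
        6 * sqrt (real r ^ 3 * (1 - p) * \<mu> * L ^ 3) / var_N"
      using count_kolmogorov_bound[OF var_pos, of z] by (simp add: cdf_eq Phi_def)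
    also have "\<dots> \<le> 6 * sqrt (real r ^ 3 * (1 - p) * (K * P) * L ^ 3) / (k * ((1 - p) * P\<^sup>2 / m))"
      using p L_nonneg radicand
      by (intro frac_le mult_left_mono real_sqrt_le_mono mult_right_mono var_ge \<mu>_le kbase) auto
    \<comment> \<open>The square of the variance scale is split off so that it leaves the root and
      cancels against the denominator.\<close>
    also have "real r ^ 3 * (1 - p) * (K * P) * L ^ 3 =
        (real r ^ 3 * K * \<Lambda> ^ 3) * (((1 - p) * P\<^sup>2 / m)\<^sup>2 * (1 / ((1 - p) * m)))"
      using p P m by (simp add: L_def power2_eq_square power3_eq_cube field_simps)
    also have "6 * sqrt \<dots> / (k * ((1 - p) * P\<^sup>2 / m)) = C / sqrt ((1 - p) * m)"
    proof -
      have "6 * sqrt (A * (B\<^sup>2 * (1 / y))) / (k * B) = 6 * sqrt A / k / sqrt y" if "0 < B" for A B y :: real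
        using that pos by (simp add: real_sqrt_mult real_sqrt_divide)
      from this[OF base] show ?thesis by (simp only: C_def)
    qed
    finally show "\<bar>cdf (normalized_count_law (cycle_graph r) n p) z - cdf std_normal_distribution z\<bar> \<le>
        C / sqrt ((1 - p) * min (real n ^ 2 * p) ((real n * p) ^ r))"
      by (simp add: m_def P_def)
  qed
  ultimately show thesis by (rule that)
qed

text \<open>The three ranges tell which term of the minimum in
  \<open>kolmogorov_distance_cycle_count\<close> is the smaller one and whether \<open>1 - p\<close>
  may be absorbed into the constant. For \<open>n < r\<close> there is no copy and the variance is
  0, which is why \<open>n\<close> starts at \<open>r\<close>.\<close>

theorem corollary4p4:
  fixes r :: nat and c :: real
  assumes "r \<ge> 3" and "0 < c" and "c < 1"
  shows "\<exists>C > 0. \<forall>p :: nat \<Rightarrow> real. (\<forall>n. 0 < p n \<and> p n < 1) \<longrightarrow>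
    (\<forall>n \<ge> r.
      (c < p n \<longrightarrow>
        kolmogorov_distance (normalized_count_law (cycle_graph r) n (p n)) std_normal_distribution
          \<le> C * (1 / (real n * sqrt (1 - p n)))) \<and>
      (real n powr (- ((real r - 2) / (real r - 1))) < p n \<and> p n \<le> c \<longrightarrow>
        kolmogorov_distance (normalized_count_law (cycle_graph r) n (p n)) std_normal_distribution
          \<le> C * (1 / (real n * sqrt (p n)))) \<and>
      (p n \<le> real n powr (- ((real r - 2) / (real r - 1))) \<longrightarrow>
        kolmogorov_distance (normalized_count_law (cycle_graph r) n (p n)) std_normal_distribution
          \<le> C * (1 / (real n * p n) powr (real r / 2))))"
proof -
  obtain C0 where C0: "C0 > 0" and bound: "\<And>n p. r \<le> n \<Longrightarrow> 0 < p \<Longrightarrow> p < 1 \<Longrightarrow> 1 \<le> real n * p \<Longrightarrow>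
    kolmogorov_distance (normalized_count_law (cycle_graph r) n p) std_normal_distribution \<le>
    C0 / sqrt ((1 - p) * min (real n ^ 2 * p) ((real n * p) ^ r))"
    using kolmogorov_distance_cycle_count[OF assms(1)] by metis
  define d where "d n p = kolmogorov_distance (normalized_count_law (cycle_graph r) n p) std_normal_distribution" for n p
  \<comment> \<open>The first three summands serve the dense, middle and sparse range in this order.
    The last makes the bound trivial in the dense range if \<open>real n * p < 1\<close>, and gives
    \<open>1 \<le> C\<close> for the same purpose in the sparse range.\<close>
  define C where "C = C0 / sqrt (c ^ r) + C0 / sqrt (1 - c) + 2 * C0 + 1 / c"
  have parts: "0 < C0 / sqrt (c ^ r)" "0 < C0 / sqrt (1 - c)" "0 < 2 * C0" "0 < 1 / c"
    using C0 assms by auto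
  then have C_ge: "C0 / sqrt (c ^ r) \<le> C" "C0 / sqrt (1 - c) \<le> C" "2 * C0 \<le> C" "1 / c \<le> C"
    and C_pos: "C > 0" unfolding C_def by linarith+
  have "1 \<le> 1 / c" using assms by simp
  then have C1: "1 \<le> C" using C_ge(4) by linarith
  let ?x = "(real r - 2) / (real r - 1)"
  \<comment> \<open>The upper estimate yields \<open>1 \<le> real n * p\<close> in the middle range;
    the lower one keeps \<open>p\<close> away from 1 in the sparse range.\<close>
  have x: "1 / 2 \<le> ?x" "?x \<le> 1" using assms(1) by (auto simp: field_simps)
  \<comment> \<open>The left side of the inequality is the quotient of
    \<open>(real n * p) ^ r\<close> by \<open>real n ^ 2 * p\<close>, so the threshold is the point
    where the two terms of the minimum are equal.\<close>
  have power_le_iff: "p ^ (r - 1) * real n ^ (r - 2) \<le> 1 \<longleftrightarrow> p \<le> real n powr (- ?x)"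
    if "r \<le> n" "0 < p" for n and p :: real
  proof -
    have n: "0 < real n" using that assms by simp
    have "(real n powr (- ?x)) ^ (r - 1) = real n powr (- (real r - 2))"
      using n assms(1) by (simp add: powr_realpow[symmetric] powr_powr of_nat_diff)
    also have "\<dots> = 1 / real n powr (real r - 2)"
      by (rule powr_minus_divide)
    also have "real n powr (real r - 2) = real n ^ (r - 2)"
      using powr_realpow[OF n, of "r - 2"] assms(1) by (simp add: of_nat_diff)
    finally have eq: "(real n powr (- ?x)) ^ (r - 1) = 1 / real n ^ (r - 2)" .
    have "p \<le> real n powr (- ?x) \<longleftrightarrow> p ^ (r - 1) \<le> (real n powr (- ?x)) ^ (r - 1)"
      using that assms(1) by (intro power_mono_iff[symmetric]) auto
    then show ?thesis unfolding eq using n by (simp add: field_simps)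
  qed
  have split: "(real n * p) ^ r = real n ^ 2 * p * (p ^ (r - 1) * real n ^ (r - 2))" for n and p :: real
  proof -
    have "r = 1 + (r - 1)" "r = 2 + (r - 2)" using assms(1) by auto
    then have "p ^ r = p ^ 1 * p ^ (r - 1)" "real n ^ r = real n ^ 2 * real n ^ (r - 2)"
      by (metis power_add)+
    then show ?thesis by (simp add: power_mult_distrib mult_ac)
  qed
  have "d n p \<le> C * (1 / (real n * sqrt (1 - p)))" if n: "r \<le> n" and p: "0 < p" "p < 1" and "c < p" for n p
  proof (cases "1 \<le> real n * p")
    case True
    have n1: "1 \<le> real n" using n assms by simp
    \<comment> \<open>With \<open>p > c\<close>, both terms of the minimum are at least
      \<open>real n ^ 2 * c ^ r\<close>.\<close>
    have "c ^ r \<le> c ^ 1" using assms by (intro power_decreasing) auto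
    then have "real n ^ 2 * c ^ r \<le> real n ^ 2 * p" 
      using \<open>c < p\<close> by (intro mult_left_mono) auto
    moreover have "real n ^ 2 * c ^ r \<le> real n ^ r * p ^ r"
      using n1 assms \<open>c < p\<close> by (intro mult_mono power_increasing power_mono) auto
    ultimately have "real n ^ 2 * c ^ r \<le> min (real n ^ 2 * p) ((real n * p) ^ r)"
      by (simp add: power_mult_distrib)
    then have "d n p \<le> C0 / sqrt ((1 - p) * (real n ^ 2 * c ^ r))"
      unfolding d_def using C0 p n1 assms
      by (intro order_trans[OF bound[OF n p True]] divide_left_mono real_sqrt_le_mono mult_left_mono) auto
    also have "\<dots> = C0 / sqrt (c ^ r) * (1 / (real n * sqrt (1 - p)))"
      by (simp add: real_sqrt_mult mult_ac)
    also have "\<dots> \<le> C * (1 / (real n * sqrt (1 - p)))"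
      using C_ge p by (intro mult_right_mono) auto
    finally show ?thesis .
  next
    case False
    have n1: "1 \<le> real n" using n assms by simp
    \<comment> \<open>\<open>real n * p < 1\<close> and \<open>c < p\<close> leave only
      \<open>n\<close> below \<open>1 / c\<close>, where the claimed bound is at least 1.\<close>
    have "real n * sqrt (1 - p) \<le> real n * 1"
      using p by (intro mult_left_mono) auto
    also have "real n * c \<le> real n * p" using \<open>c < p\<close> by (intro mult_left_mono) auto
    then have "real n * 1 \<le> 1 / c" using False assms by (simp add: field_simps)
    finally have "real n * sqrt (1 - p) \<le> C" using C_ge(4) by linarith
    then have "1 \<le> C * (1 / (real n * sqrt (1 - p)))"
      using p n1 by simp
    then show ?thesis
      using kolmogorov_distance_law_le_1[of "cycle_graph r" n p] unfolding d_def by linarith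
  qed
  moreover have "d n p \<le> C * (1 / (real n * sqrt p))"
    if n: "r \<le> n" and p: "0 < p" "p < 1" and gt: "real n powr (- ?x) < p" and "p \<le> c" for n p
  proof -
    have n1: "1 \<le> real n" using n assms by simp
    have "real n powr (- 1) \<le> real n powr (- ?x)"
      using x n1 by (intro powr_mono) auto
    moreover have "real n powr (- 1) = 1 / real n"
      using n1 by (simp add: powr_minus_divide)
    ultimately have "1 / real n < p" using gt by linarith
    then have np: "1 \<le> real n * p"
      using n1 by (simp add: field_simps)
    have "1 \<le> p ^ (r - 1) * real n ^ (r - 2)"
      using power_le_iff[OF n p(1)] gt by linarith
    then have "real n ^ 2 * p * 1 \<le> (real n * p) ^ r"
      unfolding split using p by (intro mult_left_mono) auto
    then have "min (real n ^ 2 * p) ((real n * p) ^ r) = real n ^ 2 * p" by simp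
    then have "d n p \<le> C0 / sqrt ((1 - p) * (real n ^ 2 * p))"
      unfolding d_def using bound[OF n p np] by simp
    also have "\<dots> \<le> C0 / sqrt ((1 - c) * (real n ^ 2 * p))"
      using C0 p n1 assms \<open>p \<le> c\<close>
      by (intro divide_left_mono real_sqrt_le_mono mult_right_mono mult_pos_pos real_sqrt_gt_zero) auto
    also have "\<dots> = C0 / sqrt (1 - c) * (1 / (real n * sqrt p))"
      by (simp add: real_sqrt_mult)
    also have "\<dots> \<le> C * (1 / (real n * sqrt p))"
      using C_ge p by (intro mult_right_mono) auto
    finally show ?thesis .
  qed
  moreover have "d n p \<le> C * (1 / (real n * p) powr (real r / 2))"
    if n: "r \<le> n" and p: "0 < p" "p < 1" and le: "p \<le> real n powr (- ?x)" for n p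
  proof (cases "1 \<le> real n * p")
    case True
    have n3: "3 \<le> real n" using n assms by simp
    have "p \<le> real n powr (- (1 / 2))"
      using x n3 by (intro order_trans[OF le] powr_mono) auto
    also have "\<dots> = 1 / sqrt (real n)"
      using n3 by (simp add: powr_minus powr_half_sqrt field_simps)
    \<comment> \<open>\<open>16 / 9\<close> is a number below 3 with rational square root; it gives
      \<open>p \<le> 3 / 4\<close>.\<close>
    also have "\<dots> \<le> 1 / sqrt (16 / 9)"
      using n3 by (intro divide_left_mono real_sqrt_le_mono) auto
    also have "sqrt (16 / 9) = 4 / (3 :: real)"
      by (rule real_sqrt_unique) (auto simp: power2_eq_square)
    finally have p_le: "1 / 4 \<le> 1 - p" by simp
    have "real n ^ 2 * p * (p ^ (r - 1) * real n ^ (r - 2)) \<le> real n ^ 2 * p * 1"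
      using power_le_iff[OF n p(1)] le p by (intro mult_left_mono) auto
    then have "min (real n ^ 2 * p) ((real n * p) ^ r) = (real n * p) ^ r"
      unfolding split by simp
    then have "d n p \<le> C0 / sqrt ((1 - p) * (real n * p) ^ r)"
      unfolding d_def using bound[OF n p True] by simp
    also have "\<dots> \<le> C0 / sqrt (1 / 4 * (real n * p) ^ r)"
      using C0 p n3 p_le
      by (intro divide_left_mono real_sqrt_le_mono mult_right_mono mult_pos_pos real_sqrt_gt_zero) auto
    also have "\<dots> = 2 * C0 * (1 / (real n * p) powr (real r / 2))"
    proof -
      have "sqrt ((real n * p) ^ r) = (real n * p) powr (real r / 2)"
        using True by (simp add: powr_half_sqrt[symmetric] powr_realpow[symmetric] powr_powr)
      moreover have "sqrt (1 / 4) = 1 / (2 :: real)"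
        by (rule real_sqrt_unique) (auto simp: power2_eq_square)
      ultimately show ?thesis by (simp only: real_sqrt_mult) simp
    qed
    also have "\<dots> \<le> C * (1 / (real n * p) powr (real r / 2))"
      using C_ge by (intro mult_right_mono) auto
    finally show ?thesis .
  next
    case False
    have pos: "0 < real n * p" using n p assms(1) by (intro mult_pos_pos) auto
    have "(real n * p) powr (real r / 2) \<le> 1"
      using False pos by (intro powr_le1) auto
    then have "(real n * p) powr (real r / 2) \<le> C" using C1 by linarith
    moreover have "0 < (real n * p) powr (real r / 2)"
      unfolding powr_gt_zero by (rule not_sym[OF less_imp_neq[OF pos]])
    ultimately have "1 \<le> C * (1 / (real n * p) powr (real r / 2))"
      unfolding times_divide_eq_right mult_1_right by (subst le_divide_eq_1_pos)
    then show ?thesis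
      using kolmogorov_distance_law_le_1[of "cycle_graph r" n p] unfolding d_def by linarith
  qed
  ultimately show ?thesis
    unfolding d_def using C_pos by (intro exI[of _ C]) blast
qed

end
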